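(* Let $X$ be a finite graph with vertices labeled $v_1,\dots,v_g$, $G$ a finite abelian group, $\alpha:\mathbf{E}_X\to G$ with $\alpha(\bar s)=\alpha(s)^{-1}$, and $\mathcal{G}=\{G_i\le G\}_{i=1}^g$ (with $G_i$ attached to $v_i$); let $Y=X(G,\mathcal{G},\alpha)$ with its $G$-action. For each $\psi\in\widehat G$, $$(1-u^2)^{r_0(\psi)}h(u,\psi)=z(u,\psi).$$ Moreover, if $\widetilde{\mathbf{A}}_\alpha,\widetilde{\mathbf{C}},\widetilde{\mathbf{D}}$ are obtained from $\mathbf{A}_\alpha,\mathbf{C},\mathbf{D}$ by deleting the rows and columns with indices $i$ such that $G_i\not\subseteq\ker\psi$, then $$h(u,\psi)=\det\big(\widetilde I-\psi(\widetilde{\mathbf{A}}_\alpha)\psi(\widetilde{\mathbf{C}})u+(\psi(\widetilde{\mathbf{D}})\psi(\widetilde{\mathbf{C}})-\widetilde I)u^2\big),$$ where $\widetilde I$ is the identity matrix of size $|V_X|-r_0(\psi)$.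
   Context: Graphs in Serre's sense (vertices $V$, directed edges $\mathbf{E}$, maps $o,t$, fixed-point-free involution $\varepsilon\mapsto\bar\varepsilon$ with $o(\bar\varepsilon)=t(\varepsilon)$); $\mathrm{val}(w)=|\{\varepsilon:o(\varepsilon)=w\}|$. The graph $Y=X(G,\mathcal{G},\alpha)$ has vertices $(v_i,\sigma G_i)$, directed edges $(s,\sigma)\in\mathbf{E}_X\times G$, $o(s,\sigma)=(o(s),\sigma G_{o(s)})$, $t(s,\sigma)=(t(s),\sigma\alpha(s)G_{t(s)})$, $\overline{(s,\sigma)}=(\bar s,\sigma\alpha(s))$; $G$ acts by left multiplication on the second coordinate (without inversion, freely on directed edges). $C_0(Y)=\mathbb{C}V_Y$, $\mathcal{D}(w)=\mathrm{val}_Y(w)w$, $\mathcal{A}(w)=\sum_{o(\varepsilon)=w}t(\varepsilon)$, $\eta_Y(u)=\det_{\mathbb{C}[G][u]}(\mathcal{I}-\mathcal{A}u+(\mathcal{D}-\mathcal{I})u^2)$ on $C_0(Y)[u]$ (determinant of an endomorphism $f$ of a finitely generated projective module $M$ is $\det(f\oplus\mathrm{id}_N)$ with $M\oplus N$ free); $h(u,\psi)=\psi(\eta_Y(u))$ for $\psi\in\widehat G$ (homomorphisms $G\to\mathbb{C}^\times$, extended linearly to $\mathbb{C}[G]$ and coefficientwise). $r_0(\psi)=|\{i:G_i\not\subseteq\ker\psi\}|$. Matrices in $M_g(\mathbb{Z}[G])$: $\mathbf{A}_\alpha$ with $(i,j)$ entry $\sum_{s\in\mathbf{E}_X,\,o(s)=v_j,\,t(s)=v_i}\alpha(s)$;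 $\mathbf{C}$ diagonal with $\mathbf{c}_{ii}=\sum_{h\in G_i}h$; $\mathbf{D}$ the degree matrix of $X$ (diagonal, entries $\mathrm{val}_X(v_i)$); $\mathbf{I}$ identity. $\xi_Y(u)=\det(\mathbf{I}-\mathbf{A}_\alpha\mathbf{C}u+(\mathbf{D}\mathbf{C}-\mathbf{I})u^2)$ and $z(u,\psi)=\psi(\xi_Y(u))$; $\psi$ applied to matrices entrywise. *)

theory Defs
  imports
    "HOL-Library.Poly_Mapping"
    "HOL-Analysis.Product_Vector"
    "Jordan_Normal_Form.Determinant"
    "Jordan_Normal_Form.DL_Submatrix"
begin

section \<open>Graphs in the sense of Serre\<close>

record ('v, 'e) sgraph =
  verts :: "'v set"
  dedges :: "'e set"
  orig :: "'e \<Rightarrow> 'v"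
  termin :: "'e \<Rightarrow> 'v"
  bar :: "'e \<Rightarrow> 'e"

definition serre_graph :: "('v, 'e) sgraph \<Rightarrow> bool" where
  "serre_graph X \<longleftrightarrow>
     (\<forall>e\<in>dedges X. orig X e \<in> verts X \<and> termin X e \<in> verts X \<and> bar X e \<in> dedges X \<and>
        bar X (bar X e) = e \<and> bar X e \<noteq> e \<and> orig X (bar X e) = termin X e)"

definition finite_graph :: "('v, 'e) sgraph \<Rightarrow> bool" where
  "finite_graph X \<longleftrightarrow> serre_graph X \<and> finite (verts X) \<and> finite (dedges X)"

definition val :: "('v, 'e) sgraph \<Rightarrow> 'v \<Rightarrow> nat" where
  "val X w = card {e \<in> dedges X. orig X e = w}"


section \<open>The graph \<open>X(G, \<G>, \<alpha>)\<close>\<close>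

text \<open>
  The finite abelian group \<open>G\<close> is a type of class \<open>{finite, ab_group_add}\<close>, written additively.
  The family \<open>\<G>\<close> is indexed by the vertices: \<open>H w\<close> is the subgroup attached to \<open>w\<close>.
\<close>

definition is_subgroup :: "'g::ab_group_add set \<Rightarrow> bool" where
  "is_subgroup S \<longleftrightarrow> 0 \<in> S \<and> (\<forall>a\<in>S. \<forall>b\<in>S. a + b \<in> S) \<and> (\<forall>a\<in>S. - a \<in> S)"

definition voltage :: "('v, 'e) sgraph \<Rightarrow> ('e \<Rightarrow> 'g::ab_group_add) \<Rightarrow> bool" where
  "voltage X \<alpha> \<longleftrightarrow> (\<forall>s\<in>dedges X. \<alpha> (bar X s) = - \<alpha> s)"

definition coset :: "'g::ab_group_add \<Rightarrow> 'g set \<Rightarrow> 'g set" where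
  "coset \<sigma> S = (\<lambda>h. \<sigma> + h) ` S"

definition derived_graph ::
  "('v, 'e) sgraph \<Rightarrow> ('v \<Rightarrow> 'g::ab_group_add set) \<Rightarrow> ('e \<Rightarrow> 'g) \<Rightarrow> ('v \<times> 'g set, 'e \<times> 'g) sgraph" where
  "derived_graph X H \<alpha> =
     \<lparr> verts = {(w, coset \<sigma> (H w)) | w \<sigma>. w \<in> verts X},
       dedges = dedges X \<times> UNIV,
       orig = (\<lambda>(s, \<sigma>). (orig X s, coset \<sigma> (H (orig X s)))),
       termin = (\<lambda>(s, \<sigma>). (termin X s, coset (\<sigma> + \<alpha> s) (H (termin X s)))),
       bar = (\<lambda>(s, \<sigma>). (bar X s, \<sigma> + \<alpha> s)) \<rparr>"

definition vertex_act :: "'g::ab_group_add \<Rightarrow> 'v \<times> 'g set \<Rightarrow> 'v \<times> 'g set" where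
  "vertex_act \<tau> = (\<lambda>(w, S). (w, coset \<tau> S))"

lemma serre_graph_derived_graph:
  assumes "serre_graph X" "voltage X \<alpha>"
  shows "serre_graph (derived_graph X H \<alpha>)"
proof -
  have "orig X e \<in> verts X" "termin X e \<in> verts X" "bar X e \<in> dedges X" "bar X (bar X e) = e"
    "bar X e \<noteq> e" "orig X (bar X e) = termin X e" "\<alpha> (bar X e) = - \<alpha> e"
    if "e \<in> dedges X" for e
    using assms that unfolding serre_graph_def voltage_def by blast+
  then show ?thesis
    unfolding serre_graph_def derived_graph_def by auto
qed


section \<open>Determinants of endomorphisms of finitely generated projective modules\<close>

definition pm_scale :: "'r::comm_ring_1 \<Rightarrow> ('w \<Rightarrow>\<^sub>0 'r) \<Rightarrow> ('w \<Rightarrow>\<^sub>0 'r)" where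
  "pm_scale c = Poly_Mapping.map ((*) c)"

lemma lookup_pm_scale [simp]: "Poly_Mapping.lookup (pm_scale c x) k = c * Poly_Mapping.lookup x k"
  by (simp add: pm_scale_def Poly_Mapping.map.rep_eq when_def)

lemma module_pm_scale: "Modules.module pm_scale"
  by standard (auto intro!: poly_mapping_eqI simp: lookup_add algebra_simps)

text \<open>
  \<open>is_endo_det s M N f d\<close>: the module \<open>M \<oplus> N\<close>, where \<open>M\<close> is a submodule of the ambient module
  with scalar multiplication \<open>s\<close>, has the finite basis \<open>bs\<close>, and \<open>d\<close> is the determinant of the
  matrix \<open>B\<close> of \<open>f \<oplus> id\<close> with respect to \<open>bs\<close>. If \<open>M \<oplus> N\<close> is free of finite rank,
  then \<open>N\<close> is isomorphic to a submodule of the free module \<open>nat \<Rightarrow>\<^sub>0 'r\<close>, so that taking only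
  submodules of the latter as complements loses nothing.
\<close>

definition is_endo_det ::
  "('r::comm_ring_1 \<Rightarrow> 'm::ab_group_add \<Rightarrow> 'm) \<Rightarrow> 'm set \<Rightarrow> (nat \<Rightarrow>\<^sub>0 'r) set \<Rightarrow> ('m \<Rightarrow> 'm) \<Rightarrow> 'r \<Rightarrow> bool" where
  "is_endo_det s M N f d \<longleftrightarrow>
     (let s' = module_prod.scale s pm_scale in
      \<exists>bs B. distinct bs \<and> \<not> module.dependent s' (set bs) \<and> module.span s' (set bs) = M \<times> N \<and>
        B \<in> carrier_mat (length bs) (length bs) \<and>
        (\<forall>j < length bs. map_prod f id (bs ! j) = (\<Sum>i < length bs. s' (B $$ (i, j)) (bs ! i))) \<and>
        d = det B)"

definition endo_det ::
  "('r::comm_ring_1 \<Rightarrow> 'm::ab_group_add \<Rightarrow> 'm) \<Rightarrow> 'm set \<Rightarrow> ('m \<Rightarrow> 'm) \<Rightarrow> 'r" where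
  "endo_det s M f = (THE d. \<exists>N. module.subspace pm_scale N \<and> is_endo_det s M N f d)"


section \<open>The operators on \<open>C\<^sub>0(Y)\<close> and \<open>\<eta>\<^sub>Y\<close>\<close>

definition C0 :: "('w, 'e) sgraph \<Rightarrow> ('w \<Rightarrow>\<^sub>0 complex) set" where
  "C0 Y = {x. Poly_Mapping.keys x \<subseteq> verts Y}"

definition lin_ext :: "('w \<Rightarrow> ('w \<Rightarrow>\<^sub>0 complex)) \<Rightarrow> ('w \<Rightarrow>\<^sub>0 complex) \<Rightarrow> ('w \<Rightarrow>\<^sub>0 complex)" where
  "lin_ext F x = (\<Sum>w\<in>Poly_Mapping.keys x. pm_scale (Poly_Mapping.lookup x w) (F w))"

definition deg_op :: "('w, 'e) sgraph \<Rightarrow> ('w \<Rightarrow>\<^sub>0 complex) \<Rightarrow> ('w \<Rightarrow>\<^sub>0 complex)" where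
  "deg_op Y = lin_ext (\<lambda>w. Poly_Mapping.single w (of_nat (val Y w)))"

definition adj_op :: "('w, 'e) sgraph \<Rightarrow> ('w \<Rightarrow>\<^sub>0 complex) \<Rightarrow> ('w \<Rightarrow>\<^sub>0 complex)" where
  "adj_op Y = lin_ext (\<lambda>w. \<Sum>e\<in>{e \<in> dedges Y. orig Y e = w}. Poly_Mapping.single (termin Y e) 1)"

text \<open>The group ring \<open>\<complex>[G]\<close> is the type \<open>'g \<Rightarrow>\<^sub>0 complex\<close> with the convolution product.\<close>

definition group_ring_scale ::
  "('g \<Rightarrow> 'w \<Rightarrow> 'w) \<Rightarrow> ('g \<Rightarrow>\<^sub>0 complex) \<Rightarrow> ('w \<Rightarrow>\<^sub>0 complex) \<Rightarrow> ('w \<Rightarrow>\<^sub>0 complex)" where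
  "group_ring_scale act a x =
     (\<Sum>\<tau>\<in>Poly_Mapping.keys a. \<Sum>w\<in>Poly_Mapping.keys x. Poly_Mapping.single (act \<tau> w) (Poly_Mapping.lookup a \<tau> * Poly_Mapping.lookup x w))"

text \<open>For an \<open>'r\<close>-module structure \<open>s\<close> on \<open>'m\<close>, the \<open>'r[u]\<close>-module structure on \<open>'m[u]\<close>.\<close>

definition poly_scale ::
  "('r::zero \<Rightarrow> 'm::comm_monoid_add \<Rightarrow> 'm) \<Rightarrow> 'r poly \<Rightarrow> 'm poly \<Rightarrow> 'm poly" where
  "poly_scale s p q =
     (\<Sum>i\<le>Polynomial.degree p. \<Sum>j\<le>Polynomial.degree q.
        Polynomial.monom (s (Polynomial.coeff p i) (Polynomial.coeff q j)) (i + j))"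

definition C0_poly :: "('w, 'e) sgraph \<Rightarrow> ('w \<Rightarrow>\<^sub>0 complex) poly set" where
  "C0_poly Y = {q. \<forall>n. Polynomial.coeff q n \<in> C0 Y}"

text \<open>The operator \<open>\<I> - \<A>u + (\<D> - \<I>)u\<^sup>2\<close>; multiplication by \<open>u\<close> is \<open>pCons 0\<close>.\<close>

definition ihara_op ::
  "('w, 'e) sgraph \<Rightarrow> ('w \<Rightarrow>\<^sub>0 complex) poly \<Rightarrow> ('w \<Rightarrow>\<^sub>0 complex) poly" where
  "ihara_op Y q =
     q - pCons 0 (map_poly (adj_op Y) q)
       + pCons 0 (pCons 0 (map_poly (\<lambda>x. deg_op Y x - x) q))"

definition eta ::
  "('g::ab_group_add \<Rightarrow> 'w \<Rightarrow> 'w) \<Rightarrow> ('w, 'e) sgraph \<Rightarrow> ('g \<Rightarrow>\<^sub>0 complex) poly" where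
  "eta act Y = endo_det (poly_scale (group_ring_scale act)) (C0_poly Y) (ihara_op Y)"


section \<open>Characters\<close>

definition is_character :: "('g::ab_group_add \<Rightarrow> complex) \<Rightarrow> bool" where
  "is_character \<psi> \<longleftrightarrow> (\<forall>a. \<psi> a \<noteq> 0) \<and> (\<forall>a b. \<psi> (a + b) = \<psi> a * \<psi> b)"

definition char_ker :: "('g \<Rightarrow> complex) \<Rightarrow> 'g set" where
  "char_ker \<psi> = {a. \<psi> a = 1}"

definition char_ext :: "('g \<Rightarrow> complex) \<Rightarrow> ('g \<Rightarrow>\<^sub>0 complex) \<Rightarrow> complex" where
  "char_ext \<psi> x = (\<Sum>a\<in>Poly_Mapping.keys x. Poly_Mapping.lookup x a * \<psi> a)"

text \<open>The restriction of \<open>char_ext \<psi>\<close> to \<open>\<int>[G]\<close>.\<close>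

definition char_ext_int :: "('g \<Rightarrow> complex) \<Rightarrow> ('g \<Rightarrow>\<^sub>0 int) \<Rightarrow> complex" where
  "char_ext_int \<psi> x = char_ext \<psi> (Poly_Mapping.map of_int x)"

definition h_fun ::
  "('v, 'e) sgraph \<Rightarrow> ('v \<Rightarrow> 'g::ab_group_add set) \<Rightarrow> ('e \<Rightarrow> 'g) \<Rightarrow> ('g \<Rightarrow> complex) \<Rightarrow> complex poly" where
  "h_fun X H \<alpha> \<psi> = map_poly (char_ext \<psi>) (eta vertex_act (derived_graph X H \<alpha>))"


section \<open>The matrices over \<open>\<int>[G]\<close> and \<open>\<xi>\<^sub>Y\<close>\<close>

text \<open>The vertices of \<open>X\<close> are labelled \<open>v 0, \<dots>, v (g - 1)\<close>.\<close>

definition r0 :: "nat \<Rightarrow> (nat \<Rightarrow> 'v) \<Rightarrow> ('v \<Rightarrow> 'g set) \<Rightarrow> ('g \<Rightarrow> complex) \<Rightarrow> nat" where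
  "r0 g v H \<psi> = card {i. i < g \<and> \<not> H (v i) \<subseteq> char_ker \<psi>}"

definition A_mat ::
  "nat \<Rightarrow> (nat \<Rightarrow> 'v) \<Rightarrow> ('v, 'e) sgraph \<Rightarrow> ('e \<Rightarrow> 'g::ab_group_add) \<Rightarrow> ('g \<Rightarrow>\<^sub>0 int) mat" where
  "A_mat g v X \<alpha> = mat g g (\<lambda>(i, j).
     \<Sum>s\<in>{s \<in> dedges X. orig X s = v j \<and> termin X s = v i}. Poly_Mapping.single (\<alpha> s) 1)"

definition C_mat ::
  "nat \<Rightarrow> (nat \<Rightarrow> 'v) \<Rightarrow> ('v \<Rightarrow> 'g::ab_group_add set) \<Rightarrow> ('g \<Rightarrow>\<^sub>0 int) mat" where
  "C_mat g v H = mat g g (\<lambda>(i, j). if i = j then \<Sum>a\<in>H (v i). Poly_Mapping.single a 1 else 0)"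

definition D_mat ::
  "nat \<Rightarrow> (nat \<Rightarrow> 'v) \<Rightarrow> ('v, 'e) sgraph \<Rightarrow> ('g::ab_group_add \<Rightarrow>\<^sub>0 int) mat" where
  "D_mat g v X = mat g g (\<lambda>(i, j). if i = j then of_nat (val X (v i)) else 0)"

text \<open>\<open>det(I - ACu + (DC - I)u\<^sup>2)\<close> for matrices of size \<open>n\<close>.\<close>

definition ihara_det :: "nat \<Rightarrow> 'r::comm_ring_1 mat \<Rightarrow> 'r mat \<Rightarrow> 'r mat \<Rightarrow> 'r poly" where
  "ihara_det n A C D =
     det (1\<^sub>m n - [:0, 1:] \<cdot>\<^sub>m map_mat (\<lambda>x. [:x:]) (A * C)
            + [:0, 1:]\<^sup>2 \<cdot>\<^sub>m map_mat (\<lambda>x. [:x:]) (D * C - 1\<^sub>m n))"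

definition xi ::
  "nat \<Rightarrow> (nat \<Rightarrow> 'v) \<Rightarrow> ('v, 'e) sgraph \<Rightarrow> ('v \<Rightarrow> 'g::ab_group_add set) \<Rightarrow> ('e \<Rightarrow> 'g)
     \<Rightarrow> ('g \<Rightarrow>\<^sub>0 int) poly" where
  "xi g v X H \<alpha> = ihara_det g (A_mat g v X \<alpha>) (C_mat g v H) (D_mat g v X)"

definition z_fun ::
  "nat \<Rightarrow> (nat \<Rightarrow> 'v) \<Rightarrow> ('v, 'e) sgraph \<Rightarrow> ('v \<Rightarrow> 'g::ab_group_add set) \<Rightarrow> ('e \<Rightarrow> 'g)
     \<Rightarrow> ('g \<Rightarrow> complex) \<Rightarrow> complex poly" where
  "z_fun g v X H \<alpha> \<psi> = map_poly (char_ext_int \<psi>) (xi g v X H \<alpha>)"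

definition trim :: "nat \<Rightarrow> (nat \<Rightarrow> 'v) \<Rightarrow> ('v \<Rightarrow> 'g set) \<Rightarrow> ('g \<Rightarrow> complex) \<Rightarrow> 'a mat \<Rightarrow> 'a mat" where
  "trim g v H \<psi> B =
     (let K = {i. i < g \<and> H (v i) \<subseteq> char_ker \<psi>} in submatrix B K K)"


section \<open>The scalar multiplications are module structures\<close>

lemma coset_0: "coset 0 S = S"
  by (simp add: coset_def)

lemma coset_coset: "coset a (coset b S) = coset (a + b) S"
  by (simp add: coset_def image_image add.assoc)

lemma vertex_act_0: "vertex_act 0 w = w"
  by (simp add: vertex_act_def coset_0 split: prod.split)

lemma vertex_act_add: "vertex_act (a + b) w = vertex_act a (vertex_act b w)"
  by (simp add: vertex_act_def coset_coset split: prod.split)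

lemma vertex_act_in_verts:
  "w \<in> verts (derived_graph X H \<alpha>) \<Longrightarrow> vertex_act a w \<in> verts (derived_graph X H \<alpha>)"
  by (auto simp: vertex_act_def derived_graph_def coset_coset)

lemma group_ring_scale_superset:
  assumes "finite S" "finite T" "Poly_Mapping.keys a \<subseteq> S" "Poly_Mapping.keys x \<subseteq> T"
  shows "group_ring_scale act a x = (\<Sum>\<tau>\<in>S. \<Sum>w\<in>T. Poly_Mapping.single (act \<tau> w) (Poly_Mapping.lookup a \<tau> * Poly_Mapping.lookup x w))"
proof -
  have "group_ring_scale act a x = (\<Sum>\<tau>\<in>Poly_Mapping.keys a. \<Sum>w\<in>T. Poly_Mapping.single (act \<tau> w) (Poly_Mapping.lookup a \<tau> * Poly_Mapping.lookup x w))"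
    unfolding group_ring_scale_def
    by (intro sum.cong refl sum.mono_neutral_left) (use assms in \<open>auto simp: in_keys_iff\<close>)
  also have "\<dots> = (\<Sum>\<tau>\<in>S. \<Sum>w\<in>T. Poly_Mapping.single (act \<tau> w) (Poly_Mapping.lookup a \<tau> * Poly_Mapping.lookup x w))"
    by (intro sum.mono_neutral_left) (use assms in \<open>auto simp: in_keys_iff\<close>)
  finally show ?thesis .
qed

lemma group_ring_scale_add_right: "group_ring_scale act a (x + y) = group_ring_scale act a x + group_ring_scale act a y"
proof -
  let ?T = "Poly_Mapping.keys x \<union> Poly_Mapping.keys y"
  have *: "Poly_Mapping.keys (x+y) \<subseteq> ?T" by (rule Poly_Mapping.keys_add)
  show ?thesis
    by (subst (1 2 3) group_ring_scale_superset[of "Poly_Mapping.keys a" ?T])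
       (use * in \<open>auto simp: lookup_add algebra_simps single_add sum.distrib\<close>)
qed

lemma group_ring_scale_add_left: "group_ring_scale act (a + b) x = group_ring_scale act a x + group_ring_scale act b x"
proof -
  let ?T = "Poly_Mapping.keys a \<union> Poly_Mapping.keys b"
  have *: "Poly_Mapping.keys (a+b) \<subseteq> ?T" by (rule Poly_Mapping.keys_add)
  show ?thesis
    by (subst (1 2 3) group_ring_scale_superset[of ?T "Poly_Mapping.keys x"])
       (use * in \<open>auto simp: lookup_add algebra_simps single_add sum.distrib\<close>)
qed

lemma group_ring_scale_single: "group_ring_scale act (Poly_Mapping.single \<tau> c) (Poly_Mapping.single w d) = Poly_Mapping.single (act \<tau> w) (c * d)"
  by (subst group_ring_scale_superset[of "{\<tau>}" "{w}"]) auto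

lemma poly_mapping_single_induct [case_names single sum]:
  assumes s: "\<And>k v. P (Poly_Mapping.single k v)" and a: "\<And>f g. P f \<Longrightarrow> P g \<Longrightarrow> P (f + g)"
  shows "P (x :: 'a \<Rightarrow>\<^sub>0 'b::comm_monoid_add)"
proof -
  have "P (\<Sum>k\<in>A. Poly_Mapping.single k (Poly_Mapping.lookup x k))" if "finite A" for A
    using that by induction (use s[of _ 0] s a in auto)
  from this[of "Poly_Mapping.keys x"] 
  have "P (\<Sum>k\<in>Poly_Mapping.keys x. Poly_Mapping.single k (Poly_Mapping.lookup x k))" by simp
  also have "(\<Sum>k\<in>Poly_Mapping.keys x. Poly_Mapping.single k (Poly_Mapping.lookup x k)) = x"
    by (rule poly_mapping_eqI) (auto simp: lookup_sum lookup_single when_def sum.delta in_keys_iff)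
  finally show ?thesis .
qed

lemma module_group_ring_scale:
  fixes act :: "'g::ab_group_add \<Rightarrow> 'w \<Rightarrow> 'w"
  assumes act: "\<And>w. act 0 w = w" "\<And>a b w. act (a + b) w = act a (act b w)"
  shows "Modules.module (group_ring_scale act)"
proof
  fix a b :: "'g \<Rightarrow>\<^sub>0 complex" and x y :: "'w \<Rightarrow>\<^sub>0 complex"
  have z: "group_ring_scale act 0 x = 0" "group_ring_scale act a 0 = 0" for a x
    by (auto simp: group_ring_scale_def)
  show "group_ring_scale act a (x + y) = group_ring_scale act a x + group_ring_scale act a y" by (rule group_ring_scale_add_right)
  show "group_ring_scale act (a + b) x = group_ring_scale act a x + group_ring_scale act b x" by (rule group_ring_scale_add_left)
  show "group_ring_scale act 1 x = x"
  proof (induction x rule: poly_mapping_single_induct)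
    case (single k v)
    then show ?case using group_ring_scale_single[of act 0 1 k v] by (simp add: act)
  next
    case (sum f g) then show ?case by (simp add: group_ring_scale_add_right)
  qed
  show "group_ring_scale act a (group_ring_scale act b x) = group_ring_scale act (a * b) x"
  proof (induction x rule: poly_mapping_single_induct)
    case (single k v)
    show ?case
    proof (induction b rule: poly_mapping_single_induct)
      case (single k' v')
      show ?case
        by (induction a rule: poly_mapping_single_induct)
          (simp_all add: group_ring_scale_single mult_single act mult_ac distrib_right group_ring_scale_add_left)
    next
      case sum then show ?case by (simp add: group_ring_scale_add_left group_ring_scale_add_right distrib_left)
    qed
  next
    case (sum f g) then show ?case by (simp add: group_ring_scale_add_right)
  qed
qed

lemma coeff_poly_scale:
  assumes "Modules.module s"
  shows "Polynomial.coeff (poly_scale s p q) n = (\<Sum>i\<le>n. s (Polynomial.coeff p i) (Polynomial.coeff q (n - i)))"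
proof -
  interpret s: Modules.module s by fact
  let ?f = "\<lambda>i j. s (Polynomial.coeff p i) (Polynomial.coeff q j)"
  have "Polynomial.coeff (poly_scale s p q) n = (\<Sum>i\<le>Polynomial.degree p. \<Sum>j\<le>Polynomial.degree q. if i + j = n then ?f i j else 0)"
    by (simp add: poly_scale_def Polynomial.coeff_sum)
  also have "\<dots> = (\<Sum>i\<le>Polynomial.degree p. if i \<le> n then ?f i (n - i) else 0)"
  proof (rule sum.cong[OF refl])
    fix i
    have "(\<Sum>j\<le>Polynomial.degree q. if i + j = n then ?f i j else 0) = (\<Sum>j\<le>Polynomial.degree q. if j = n - i then (if i \<le> n then ?f i j else 0) else 0)"
      by (rule sum.cong) auto
    also have "\<dots> = (if i \<le> n then ?f i (n - i) else 0)"
      by (simp add: sum.delta Polynomial.coeff_eq_0)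
    finally show "(\<Sum>j\<le>Polynomial.degree q. if i + j = n then ?f i j else 0) = (if i \<le> n then ?f i (n - i) else 0)" .
  qed
  also have "\<dots> = (\<Sum>i\<in>{..Polynomial.degree p} \<inter> {..n}. ?f i (n - i))"
    by (subst sum.inter_restrict) auto
  also have "\<dots> = (\<Sum>i\<le>n. ?f i (n - i))"
    by (rule sum.mono_neutral_left) (auto, metis Polynomial.coeff_eq_0 not_le s.scale_zero_left)
  finally show ?thesis .
qed

lemma module_poly_scale:
  assumes "Modules.module s"
  shows "Modules.module (poly_scale s)"
proof -
  interpret s: Modules.module s by fact
  note c = coeff_poly_scale[OF assms]
  show ?thesis
  proof
    fix a b :: "'a poly" and x y :: "'b poly"
    show "poly_scale s a (x + y) = poly_scale s a x + poly_scale s a y"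
      by (rule poly_eqI) (simp add: c s.scale_right_distrib sum.distrib)
    show "poly_scale s (a + b) x = poly_scale s a x + poly_scale s b x"
      by (rule poly_eqI) (simp add: c s.scale_left_distrib sum.distrib)
    show "poly_scale s 1 x = x"
    proof (rule poly_eqI)
      fix n
      have "(\<Sum>i\<le>n. s (Polynomial.coeff 1 i) (Polynomial.coeff x (n - i))) = (\<Sum>i\<le>n. if i = 0 then Polynomial.coeff x n else 0)"
        by (rule sum.cong) auto
      then show "Polynomial.coeff (poly_scale s 1 x) n = Polynomial.coeff x n" by (simp add: c)
    qed
    show "poly_scale s a (poly_scale s b x) = poly_scale s (a * b) x"
    proof (rule poly_eqI)
      fix n
      have "(\<Sum>i\<le>n. \<Sum>j\<le>n - i. s (Polynomial.coeff a i * Polynomial.coeff b j) (Polynomial.coeff x (n - i - j)))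
         = (\<Sum>k\<le>n. \<Sum>i\<le>k. s (Polynomial.coeff a i * Polynomial.coeff b (k - i)) (Polynomial.coeff x (n - k)))"
        unfolding sum.Sigma[OF finite_atMost ballI[OF finite_atMost]]
        by (rule sum.reindex_bij_witness[of _ "\<lambda>(k,i). (i, k - i)" "\<lambda>(i,j). (i + j, i)"]) auto
      then show "Polynomial.coeff (poly_scale s a (poly_scale s b x)) n = Polynomial.coeff (poly_scale s (a * b) x) n"
        by (simp add: c coeff_mult s.scale_sum_right s.scale_sum_left)
    qed
  qed
qed

lemma subspace_C0_poly:
  fixes act :: "'g::ab_group_add \<Rightarrow> 'w \<Rightarrow> 'w"
  assumes "\<And>\<tau> w. w \<in> verts Y \<Longrightarrow> act \<tau> w \<in> verts Y"
     "\<And>w. act 0 w = w" "\<And>a b w. act (a + b) w = act a (act b w)"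
  shows "module.subspace (poly_scale (group_ring_scale act)) (C0_poly Y)"
proof -
  have m: "Modules.module (group_ring_scale act)" by (rule module_group_ring_scale[OF assms(2,3)])
  interpret Modules.module "poly_scale (group_ring_scale act)" by (rule module_poly_scale[OF m])
  have C: "Poly_Mapping.keys (sum f A) \<subseteq> verts Y" if "\<And>a. a \<in> A \<Longrightarrow> Poly_Mapping.keys (f a) \<subseteq> verts Y" for f :: "'z \<Rightarrow> _ \<Rightarrow>\<^sub>0 complex" and A
    using that Poly_Mapping.keys_sum[of f A] by blast
  have g: "Poly_Mapping.keys (group_ring_scale act a x) \<subseteq> verts Y" if "Poly_Mapping.keys x \<subseteq> verts Y" for a x
    unfolding group_ring_scale_def
    using that assms(1) by (intro C) (auto split: if_splits)
  show ?thesis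
  proof (rule subspaceI)
    show "0 \<in> C0_poly Y" by (simp add: C0_poly_def C0_def)
  next
    fix p q assume "p \<in> C0_poly Y" "q \<in> C0_poly Y"
    then show "p + q \<in> C0_poly Y"
      using Poly_Mapping.keys_add[of "Polynomial.coeff p _" "Polynomial.coeff q _"]
      unfolding C0_poly_def C0_def mem_Collect_eq Polynomial.coeff_add by blast
  next
    fix c q assume "q \<in> C0_poly Y"
    then have "Poly_Mapping.keys (Polynomial.coeff q n) \<subseteq> verts Y" for n
      unfolding C0_poly_def C0_def by blast
    then show "poly_scale (group_ring_scale act) c q \<in> C0_poly Y"
      unfolding C0_poly_def C0_def coeff_poly_scale[OF m] mem_Collect_eq
      by (intro allI C g)
  qed
qed

end

theory Submission
  imports Defs "Jordan_Normal_Form.Char_Poly"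
begin

text \<open>
  As a \<open>\<complex>[G][u]\<close>-module, \<open>C\<^sub>0(Y)[u]\<close> is the direct sum over the vertices \<open>v\<^sub>i\<close> of copies of the
  ideals generated by the idempotents \<open>e\<^sub>i = 1/|G\<^sub>i| \<Sum>h\<in>G\<^sub>i. h\<close>, so the ideals of the \<open>1 - e\<^sub>i\<close>
  complete it to a free module of rank \<open>g\<close>. In the resulting basis the operator has the matrix
  \<open>e\<^sub>i m\<^sub>i\<^sub>j + \<delta>\<^sub>i\<^sub>j (1 - e\<^sub>i)\<close>, where \<open>(m\<^sub>i\<^sub>j)\<close> is the matrix defining \<open>\<xi>\<^sub>Y\<close>. A character \<open>\<psi>\<close> maps
  \<open>e\<^sub>i\<close> to \<open>1\<close> or to \<open>0\<close> according to whether \<open>\<psi>\<close> is trivial on \<open>G\<^sub>i\<close>. If it is not, then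
  the \<open>i\<close>-th column becomes a unit vector on the \<open>\<eta>\<close>-side and \<open>1 - u\<^sup>2\<close> times a unit
  vector on the \<open>\<xi>\<close>-side. That the determinant does not depend on the complement, and that unit
  columns can be deleted together with their rows, both follow from \<open>det (1 + AB) = det (1 + BA)\<close>.
\<close>

section \<open>Determinants over commutative rings\<close>

text \<open>The first column is a unit vector, so Laplace expansion along it removes one row and
  column of the identity block. Induction on \<open>n\<close> does the rest, with no
  division.\<close>

lemma det_four_block_one_left:
  fixes S :: "'a::comm_ring_1 mat"
  assumes "S \<in> carrier_mat m m"
  shows "det (four_block_mat (1\<^sub>m n) (0\<^sub>m n m) (0\<^sub>m m n) S) = det S"
proof (induction n)
  case 0
  have "four_block_mat (1\<^sub>m 0) (0\<^sub>m 0 m) (0\<^sub>m m 0) S = S"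
    by (rule eq_matI) (use assms in auto)
  then show ?case by simp
next
  case (Suc n)
  let ?B = "\<lambda>n. four_block_mat (1\<^sub>m n) (0\<^sub>m n m) (0\<^sub>m m n) S"
  have c: "?B (Suc n) \<in> carrier_mat (Suc n + m) (Suc n + m)"
    using assms by auto
  have "det (?B (Suc n)) = (\<Sum>i<Suc n + m. ?B (Suc n) $$ (i, 0) * cofactor (?B (Suc n)) i 0)"
    by (rule laplace_expansion_column[OF c]) simp
  also have "\<dots> = (\<Sum>i<Suc n + m. if i = 0 then cofactor (?B (Suc n)) 0 0 else 0)"
    by (rule sum.cong) (use assms in auto)
  also have "\<dots> = det (mat_delete (?B (Suc n)) 0 0)"
    by (simp add: cofactor_def)
  also have "mat_delete (?B (Suc n)) 0 0 = ?B n"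
    by (rule eq_matI) (use assms in \<open>auto simp: mat_delete_def\<close>)
  finally show ?case using Suc by simp
qed

text \<open>The mirror image: expansion along the last column, where the sign (-1)^(2(m + n)) is
  1.\<close>

lemma det_four_block_one_right:
  fixes S :: "'a::comm_ring_1 mat"
  assumes "S \<in> carrier_mat m m"
  shows "det (four_block_mat S (0\<^sub>m m n) (0\<^sub>m n m) (1\<^sub>m n)) = det S"
proof (induction n)
  case 0
  have "four_block_mat S (0\<^sub>m m 0) (0\<^sub>m 0 m) (1\<^sub>m 0) = S"
    by (rule eq_matI) (use assms in auto)
  then show ?case by simp
next
  case (Suc n)
  let ?B = "\<lambda>n. four_block_mat S (0\<^sub>m m n) (0\<^sub>m n m) (1\<^sub>m n)"
  have c: "?B (Suc n) \<in> carrier_mat (m + Suc n) (m + Suc n)"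
    using assms by auto
  have "det (?B (Suc n)) = (\<Sum>i<m + Suc n. ?B (Suc n) $$ (i, m + n) * cofactor (?B (Suc n)) i (m + n))"
    by (rule laplace_expansion_column[OF c]) simp
  also have "\<dots> = (\<Sum>i<m + Suc n. if i = m + n then cofactor (?B (Suc n)) (m + n) (m + n) else 0)"
    by (rule sum.cong) (use assms in auto)
  also have "\<dots> = det (mat_delete (?B (Suc n)) (m + n) (m + n))"
    by (simp add: cofactor_def power_add[symmetric])
  also have "mat_delete (?B (Suc n)) (m + n) (m + n) = ?B n"
    by (rule eq_matI) (use assms in \<open>auto simp: mat_delete_def\<close>)
  finally show ?case using Suc by simp
qed

lemma det_four_block_unitriangular_lower:
  fixes B :: "'a::comm_ring_1 mat"
  assumes "B \<in> carrier_mat m n"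
  shows "det (four_block_mat (1\<^sub>m n) (0\<^sub>m n m) B (1\<^sub>m m)) = 1"
proof -
  let ?L = "four_block_mat (1\<^sub>m n) (0\<^sub>m n m) B (1\<^sub>m m)"
  have "det ?L = prod_list (diag_mat ?L)"
    by (rule det_lower_triangular[of "n + m"]) (use assms in auto)
  also have "diag_mat ?L = map (\<lambda>_. 1) [0..<n + m]"
    unfolding diag_mat_def by (rule map_cong) (use assms in auto)
  finally show ?thesis by (simp add: map_replicate_const del: map_eq_conv)
qed

lemma det_four_block_unitriangular_upper:
  fixes B :: "'a::comm_ring_1 mat"
  assumes "B \<in> carrier_mat n m"
  shows "det (four_block_mat (1\<^sub>m n) B (0\<^sub>m m n) (1\<^sub>m m)) = 1"
proof -
  let ?L = "four_block_mat (1\<^sub>m n) B (0\<^sub>m m n) (1\<^sub>m m)"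
  have "det ?L = prod_list (diag_mat ?L)"
    by (rule det_upper_triangular[of _ "n + m"]) (use assms in \<open>auto simp: upper_triangular_def\<close>)
  also have "diag_mat ?L = map (\<lambda>_. 1) [0..<n + m]"
    unfolding diag_mat_def by (rule map_cong) (use assms in auto)
  finally show ?thesis by (simp add: map_replicate_const del: map_eq_conv)
qed

text \<open>
  The block matrix \<open>[1, -A; B, 1]\<close> is factored in two ways. The block determinant formulas of the
  library are for integral domains, which \<open>\<complex>[G][u]\<close> is not.
\<close>

lemma det_one_plus_mult_commute:
  fixes A :: "'a::comm_ring_1 mat"
  assumes A: "A \<in> carrier_mat n m" and B: "B \<in> carrier_mat m n"
  shows "det (1\<^sub>m n + A * B) = det (1\<^sub>m m + B * A)"
proof -
  let ?L = "four_block_mat (1\<^sub>m n) (0\<^sub>m n m) B (1\<^sub>m m)"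
  let ?U = "four_block_mat (1\<^sub>m n) (- A) (0\<^sub>m m n) (1\<^sub>m m)"
  let ?S = "four_block_mat (1\<^sub>m n) (0\<^sub>m n m) (0\<^sub>m m n) (1\<^sub>m m + B * A)"
  let ?T = "four_block_mat (1\<^sub>m n + A * B) (0\<^sub>m n m) (0\<^sub>m m n) (1\<^sub>m m)"
  let ?M = "four_block_mat (1\<^sub>m n) (- A) B (1\<^sub>m m)"
  have L: "?L \<in> carrier_mat (n + m) (n + m)" and U: "?U \<in> carrier_mat (n + m) (n + m)"
    and S: "?S \<in> carrier_mat (n + m) (n + m)" and T: "?T \<in> carrier_mat (n + m) (n + m)"
    using A B by auto
  have nA: "- A \<in> carrier_mat n m" using A by auto
  have AB: "A * B \<in> carrier_mat n n" and BA: "B * A \<in> carrier_mat m m" using A B by auto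
  have SU: "?S * ?U = four_block_mat (1\<^sub>m n) (- A) (0\<^sub>m m n) (1\<^sub>m m + B * A)"
    by (subst mult_four_block_mat[of _ n n _ m _ m _ _ n _ m]) (use A B nA AB BA in auto)
  have "B * (- A) = - (B * A)" using A B by simp
  then have M1: "?L * (?S * ?U) = ?M"
    unfolding SU
    by (subst mult_four_block_mat[of _ n n _ m _ m _ _ n _ m]) (use A B nA AB BA in auto)
  have UT: "?U * ?T = four_block_mat (1\<^sub>m n + A * B) (- A) (0\<^sub>m m n) (1\<^sub>m m)"
    by (subst mult_four_block_mat[of _ n n _ m _ m _ _ n _ m]) (use A B nA AB BA in auto)
  have "(- A) * B = - (A * B)" using A B by simp
  then have M2: "(?U * ?T) * ?L = ?M"
    unfolding UT
    by (subst mult_four_block_mat[of _ n n _ m _ m _ _ n _ m]) (use A B nA AB BA in auto)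
  \<comment> \<open>Both factorizations consist of \<open>?L\<close>, \<open>?U\<close> and one
    block diagonal factor. The unitriangular factors have determinant 1, so
    \<open>det ?S = det ?T\<close> remains.\<close>
  have "det ?M = det ?L * (det ?S * det ?U)"
    using det_mult[OF L mult_carrier_mat[OF S U]] det_mult[OF S U] M1 by simp
  moreover have "det ?M = det ?U * det ?T * det ?L"
    using det_mult[OF mult_carrier_mat[OF U T] L] det_mult[OF U T] M2 by simp
  ultimately show ?thesis
    using det_four_block_one_left[of "1\<^sub>m m + B * A" m n]
      det_four_block_one_right[of "1\<^sub>m n + A * B" n m] det_four_block_unitriangular_lower[OF B]
      det_four_block_unitriangular_upper[OF nA] AB BA
    by simp
qed

section \<open>Uniqueness of the determinant of an endomorphism\<close>

text \<open>Two lists are allowed because the uniqueness proof needs matrices between bases of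
  possibly different lengths. Column \<open>j\<close> holds the coordinates of the image of
  \<open>bs ! j\<close>.\<close>

definition represents ::
  "('r::comm_ring_1 \<Rightarrow> 'm::ab_group_add \<Rightarrow> 'm) \<Rightarrow> 'm list \<Rightarrow> 'm list \<Rightarrow> ('m \<Rightarrow> 'm) \<Rightarrow> 'r mat \<Rightarrow> bool" where
  "represents s bs cs f A \<longleftrightarrow> A \<in> carrier_mat (length cs) (length bs) \<and>
     (\<forall>j < length bs. f (bs ! j) = (\<Sum>i < length cs. s (A $$ (i, j)) (cs ! i)))"

section \<open>Coordinates and matrices with respect to finite lists\<close>

context Modules.module
begin

lemma sum_set_conv_nth:
  assumes "distinct bs"
  shows "(\<Sum>b\<in>set bs. c b *s b) = (\<Sum>i<length bs. c (bs ! i) *s (bs ! i))"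
proof -
  have "bij_betw ((!) bs) {..<length bs} (set bs)"
    using assms by (rule bij_betw_nth) auto
  then show ?thesis
    by (simp add: sum.reindex_bij_betw[symmetric])
qed

lemma span_list:
  assumes "distinct bs"
  shows "span (set bs) = range (\<lambda>c. \<Sum>i<length bs. c i *s (bs ! i))"
proof
  show "span (set bs) \<subseteq> range (\<lambda>c. \<Sum>i<length bs. c i *s (bs ! i))"
    unfolding span_finite[OF finite_set] sum_set_conv_nth[OF assms] by auto
  show "range (\<lambda>c. \<Sum>i<length bs. c i *s (bs ! i)) \<subseteq> span (set bs)"
    by (intro image_subsetI span_sum span_scale span_base) simp
qed

lemma independent_list:
  assumes "distinct bs" "independent (set bs)" "(\<Sum>i<length bs. c i *s (bs ! i)) = 0" "i < length bs"
  shows "c i = 0"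
proof -
  \<comment> \<open>Independence of a set speaks of coefficients attached to elements. Since the
    list is distinct, the position can be recovered from the element.\<close>
  define d where "d b = c (the_inv_into {..<length bs} ((!) bs) b)" for b
  have inj: "inj_on ((!) bs) {..<length bs}"
    using assms(1) by (simp add: inj_on_nth)
  then have d: "d (bs ! k) = c k" if "k < length bs" for k
    using that by (simp add: d_def the_inv_into_f_f)
  have "(\<Sum>b\<in>set bs. d b *s b) = 0"
    using assms(3) by (simp add: sum_set_conv_nth[OF assms(1)] d)
  then have "d (bs ! i) = 0"
    using independentD[OF assms(2) finite_set subset_refl] assms(4) by simp
  then show ?thesis using d assms(4) by simp
qed

text \<open>The hypothesis concerns coefficients attached to positions, so it also excludes
  repetitions in the list.\<close>

lemma independent_listI:
  assumes "\<And>c i. (\<Sum>i<length bs. c i *s (bs ! i)) = 0 \<Longrightarrow> i < length bs \<Longrightarrow> c i = 0"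
  shows "distinct bs" "independent (set bs)"
proof -
  show d: "distinct bs"
    unfolding distinct_conv_nth
  proof (intro allI impI notI)
    fix i j assume ij: "i < length bs" "j < length bs" "i \<noteq> j" "bs ! i = bs ! j"
    \<comment> \<open>Equal entries at \<open>i\<close> and \<open>j\<close> would give a relation
      with coefficient 1 at \<open>i\<close> and -1 at \<open>j\<close>.\<close>
    let ?c = "\<lambda>k. (if k = i then 1 else 0) - (if k = j then 1 else (0::'a))"
    have "(\<Sum>k<length bs. ?c k *s (bs ! k))
        = (\<Sum>k<length bs. if k = i then bs ! k else 0) - (\<Sum>k<length bs. if k = j then bs ! k else 0)"
      unfolding sum_subtractf[symmetric] by (rule sum.cong) (auto simp: scale_left_diff_distrib)
    also have "\<dots> = 0" using ij by simp
    finally have "?c i = 0" using assms[of ?c i] ij(1) by blast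
    then show False using ij by simp
  qed
  show "independent (set bs)"
    unfolding dependent_finite[OF finite_set] sum_set_conv_nth[OF d]
  proof safe
    fix u b assume "b \<in> set bs" "u b \<noteq> 0" "(\<Sum>i<length bs. u (bs ! i) *s (bs ! i)) = 0"
    then show False using assms[of "\<lambda>i. u (bs ! i)"] by (auto simp: in_set_conv_nth)
  qed
qed

lemma represents_unique:
  assumes "represents scale bs cs f A" "represents scale bs cs f B"
    and "distinct cs" "independent (set cs)"
  shows "A = B"
proof (rule eq_matI)
  fix i j assume "i < dim_row B" "j < dim_col B"
  then have ij: "i < length cs" "j < length bs"
    using assms(2) by (auto simp: represents_def)
  have "(\<Sum>i<length cs. (A $$ (i, j) - B $$ (i, j)) *s (cs ! i)) = 0"
    using assms(1,2) ij by (simp add: represents_def scale_left_diff_distrib sum_subtractf)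
  from independent_list[OF assms(3,4) this ij(1)] show "A $$ (i, j) = B $$ (i, j)" by simp
qed (use assms in \<open>auto simp: represents_def\<close>)

lemma represents_exists:
  assumes "distinct cs" "\<And>j. j < length bs \<Longrightarrow> f (bs ! j) \<in> span (set cs)"
  shows "\<exists>A. represents scale bs cs f A"
proof -
  have "\<forall>j. \<exists>c. j < length bs \<longrightarrow> f (bs ! j) = (\<Sum>i<length cs. c i *s (cs ! i))"
    using assms(2) unfolding span_list[OF assms(1)] by blast
  then obtain c where "\<forall>j. j < length bs \<longrightarrow> f (bs ! j) = (\<Sum>i<length cs. c j i *s (cs ! i))"
    by metis
  then show ?thesis
    unfolding represents_def by (intro exI[of _ "mat (length cs) (length bs) (\<lambda>(i, j). c j i)"]) auto
qed

lemma represents_comp: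
  assumes "module_hom scale scale f" "represents scale bs cs h A" "represents scale cs ds f B"
  shows "represents scale bs ds (f \<circ> h) (B * A)"
proof -
  interpret f: module_hom scale scale f by fact
  have cA: "A \<in> carrier_mat (length cs) (length bs)" and cB: "B \<in> carrier_mat (length ds) (length cs)"
    using assms by (auto simp: represents_def)
  have "f (h (bs ! j)) = (\<Sum>i<length ds. ((B * A) $$ (i, j)) *s (ds ! i))" if j: "j < length bs" for j
  proof -
    have "f (h (bs ! j)) = (\<Sum>k<length cs. A $$ (k, j) *s (\<Sum>i<length ds. B $$ (i, k) *s (ds ! i)))"
      using assms j by (simp add: represents_def f.sum f.scale)
    also have "\<dots> = (\<Sum>i<length ds. \<Sum>k<length cs. (B $$ (i, k) * A $$ (k, j)) *s (ds ! i))"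
      by (subst sum.swap) (simp add: scale_sum_right mult.commute)
    also have "\<dots> = (\<Sum>i<length ds. ((B * A) $$ (i, j)) *s (ds ! i))"
      using cA cB j
      by (intro sum.cong refl) (simp add: scalar_prod_def scale_sum_left atLeast0LessThan)
    finally show ?thesis .
  qed
  then show ?thesis using cA cB by (simp add: represents_def)
qed

lemma represents_diff_id:
  assumes "represents scale bs bs f A"
  shows "represents scale bs bs (\<lambda>x. f x - x) (A - 1\<^sub>m (length bs))"
proof -
  have "f (bs ! j) - bs ! j = (\<Sum>i<length bs. ((A - 1\<^sub>m (length bs)) $$ (i, j)) *s (bs ! i))"
    if "j < length bs" for j
  proof -
    have "(\<Sum>i<length bs. ((A - 1\<^sub>m (length bs)) $$ (i, j)) *s (bs ! i))
      = (\<Sum>i<length bs. A $$ (i, j) *s (bs ! i)) - (\<Sum>i<length bs. if i = j then bs ! i else 0)"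
      unfolding sum_subtractf[symmetric]
      by (rule sum.cong) (use that assms in \<open>auto simp: represents_def scale_left_diff_distrib\<close>)
    then show ?thesis using that assms by (simp add: represents_def)
  qed
  then show ?thesis using assms by (auto simp: represents_def)
qed

end

lemma is_endo_det_altdef:
  "is_endo_det s M N f d \<longleftrightarrow>
     (\<exists>bs B. distinct bs \<and> \<not> module.dependent (module_prod.scale s pm_scale) (set bs) \<and>
        module.span (module_prod.scale s pm_scale) (set bs) = M \<times> N \<and>
        represents (module_prod.scale s pm_scale) bs bs (map_prod f id) B \<and> d = det B)"
  unfolding is_endo_det_def represents_def Let_def by (simp add: conj_assoc)

text \<open>
  With \<open>\<pi>\<close> the projection of \<open>M \<oplus> N\<close> and of \<open>M \<oplus> N'\<close> to \<open>M\<close> and \<open>\<gamma> = f \<oplus> id - id\<close>, we have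
  \<open>\<gamma> = \<pi> \<circ> \<gamma> \<circ> \<pi>\<close>, so that the matrices of \<open>\<gamma>\<close> for the two bases are \<open>Q (C - 1) P\<close> and
  \<open>(C - 1) P Q\<close>, where \<open>C\<close> is the matrix of \<open>f \<oplus> id\<close> for the second basis and \<open>P\<close> and \<open>Q\<close> are the matrices of \<open>\<pi>\<close> from one basis to the other.
\<close>

lemma is_endo_det_unique:
  assumes s: "Modules.module s" and f: "module_hom s s f"
    and d: "is_endo_det s M N f d" and d': "is_endo_det s M N' f d'"
  shows "d = d'"
proof -
  interpret module_prod s pm_scale
    by (simp add: module_prod_def module_pair_def s module_pm_scale)
  interpret f: module_hom s s f by fact
  obtain bs B where B: "distinct bs" "p.independent (set bs)" "p.span (set bs) = M \<times> N"
      "represents scale bs bs (map_prod f id) B" "d = det B"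
    using d unfolding is_endo_det_altdef by blast
  obtain cs C where C: "distinct cs" "p.independent (set cs)" "p.span (set cs) = M \<times> N'"
      "represents scale cs cs (map_prod f id) C" "d' = det C"
    using d' unfolding is_endo_det_altdef by blast
  define n where "n = length bs"
  define m where "m = length cs"
  define \<pi> :: "'b \<times> (nat \<Rightarrow>\<^sub>0 'a) \<Rightarrow> 'b \<times> (nat \<Rightarrow>\<^sub>0 'a)" where "\<pi> x = (fst x, 0)" for x
  define \<gamma> :: "'b \<times> (nat \<Rightarrow>\<^sub>0 'a) \<Rightarrow> 'b \<times> (nat \<Rightarrow>\<^sub>0 'a)" where "\<gamma> x = map_prod f id x - x" for x
  have \<pi>: "module_hom scale scale \<pi>"
    by unfold_locales (auto simp: \<pi>_def scale_def)
  have \<gamma>: "module_hom scale scale \<gamma>"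
    by unfold_locales
      (auto simp: \<gamma>_def scale_def f.add f.scale m1.scale_right_diff_distrib map_prod_def split_beta)
  \<comment> \<open>On the second summand the map minus the identity is zero, so
    \<open>\<gamma>\<close> ignores the second coordinate and has values with second coordinate
    0.\<close>
  have \<gamma>\<pi>: "\<pi> \<circ> (\<gamma> \<circ> \<pi>) = \<gamma>" "\<gamma> \<circ> (\<pi> \<circ> \<pi>) = \<gamma>"
    by (auto simp: \<pi>_def \<gamma>_def fun_eq_iff)
  \<comment> \<open>Both complements contain 0, so \<open>\<pi>\<close> sends each of the two free
    modules into the other, although \<open>N\<close> and \<open>N'\<close> are unrelated.\<close>
  have "(0, 0) \<in> M \<times> N" "(0, 0) \<in> M \<times> N'"
    using B(3) C(3) p.span_zero by (metis zero_prod_def)+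
  then have "\<pi> x \<in> M \<times> N" "\<pi> x \<in> M \<times> N'" if "x \<in> M \<times> N \<or> x \<in> M \<times> N'" for x
    using that by (auto simp: \<pi>_def)
  moreover have "bs ! j \<in> M \<times> N" if "j < length bs" for j
    using that B(3) p.span_base by (metis nth_mem)
  moreover have "cs ! j \<in> M \<times> N'" if "j < length cs" for j
    using that C(3) p.span_base by (metis nth_mem)
  ultimately obtain P Q where P: "represents scale bs cs \<pi> P" and Q: "represents scale cs bs \<pi> Q"
    using p.represents_exists[OF C(1), of bs \<pi>] p.represents_exists[OF B(1), of cs \<pi>] B(3) C(3)
    by auto
  have \<gamma>B: "represents scale bs bs \<gamma> (B - 1\<^sub>m n)" and \<gamma>C: "represents scale cs cs \<gamma> (C - 1\<^sub>m m)"
    using p.represents_diff_id[OF B(4)] p.represents_diff_id[OF C(4)]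
    by (simp_all add: \<gamma>_def[abs_def] n_def m_def)
  have [simp]: "B \<in> carrier_mat n n" "C \<in> carrier_mat m m" "P \<in> carrier_mat m n" "Q \<in> carrier_mat n m"
    using B(4) C(4) P Q by (auto simp: represents_def n_def m_def)
  have "represents scale bs bs \<gamma> (Q * ((C - 1\<^sub>m m) * P))"
    using p.represents_comp[OF \<pi> p.represents_comp[OF \<gamma> P \<gamma>C] Q] by (simp add: \<gamma>\<pi>)
  then have 1: "B - 1\<^sub>m n = Q * ((C - 1\<^sub>m m) * P)"
    using p.represents_unique[OF \<gamma>B _ B(1,2)] by blast
  have "represents scale cs cs \<gamma> ((C - 1\<^sub>m m) * (P * Q))"
    using p.represents_comp[OF \<gamma> p.represents_comp[OF \<pi> Q P] \<gamma>C] by (simp add: \<gamma>\<pi>)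
  then have 2: "C - 1\<^sub>m m = (C - 1\<^sub>m m) * (P * Q)"
    using p.represents_unique[OF \<gamma>C _ C(1,2)] by blast
  have add_diff: "1\<^sub>m k + (A - 1\<^sub>m k) = A" if "A \<in> carrier_mat k k" for A :: "'a mat" and k
    by (rule eq_matI) (use that in auto)
  have "det B = det (1\<^sub>m n + Q * ((C - 1\<^sub>m m) * P))"
    unfolding 1[symmetric] by (simp add: add_diff)
  also have "\<dots> = det (1\<^sub>m m + ((C - 1\<^sub>m m) * P) * Q)"
    by (rule det_one_plus_mult_commute[of _ _ m]) (auto intro!: mult_carrier_mat)
  also have "((C - 1\<^sub>m m) * P) * Q = C - 1\<^sub>m m"
    by (subst (2) 2, rule assoc_mult_mat[of _ m m _ n _ m]) auto
  finally show ?thesis using B(5) C(5) by (simp add: add_diff)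
qed

text \<open>Uniqueness across all complements turns the definite description in
  \<open>endo_det\<close> into a value that any single complement and basis compute.\<close>

lemma endo_det_eqI:
  assumes "Modules.module s" "module_hom s s f"
    and "module.subspace pm_scale N" "is_endo_det s M N f d"
  shows "endo_det s M f = d"
  unfolding endo_det_def
  by (rule the_equality) (use assms is_endo_det_unique in blast)+

text \<open>
  The \<open>i\<close>-th generator spans a copy of the ideal generated by the idempotent \<open>E i\<close>; the complement
  is spanned by the \<open>1 - E i\<close> in the \<open>i\<close>-th coordinate, and the pairs of the two form a basis.
\<close>

lemma endo_det_idempotent_generators:
  fixes s :: "'r::comm_ring_1 \<Rightarrow> 'm::ab_group_add \<Rightarrow> 'm"
  assumes s: "Modules.module s" and f: "module_hom s s f"
    and E: "\<And>i. i < n \<Longrightarrow> s (E i) (x i) = x i"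
    and ann: "\<And>c i. (\<Sum>i<n. s (c i) (x i)) = 0 \<Longrightarrow> i < n \<Longrightarrow> c i * E i = 0"
    and M: "module.span s (x ` {..<n}) = M"
    and fx: "\<And>j. j < n \<Longrightarrow> f (x j) = (\<Sum>i<n. s (a i j) (x i))"
  shows "endo_det s M f = det (mat n n (\<lambda>(i, j). E i * a i j + (if i = j then 1 - E i else 0)))"
proof -
  interpret module_prod s pm_scale
    by (simp add: module_prod_def module_pair_def s module_pm_scale)
  define y where "y i = Poly_Mapping.single i (1 - E i)" for i
  define N where "N = m2.span (y ` {..<n})"
  define bs where "bs = map (\<lambda>i. (x i, y i)) [0..<n]"
  let ?B = "mat n n (\<lambda>(i, j). E i * a i j + (if i = j then 1 - E i else 0))"
  have len: "length bs = n" and nth: "\<And>i. i < n \<Longrightarrow> bs ! i = (x i, y i)"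
    by (simp_all add: bs_def)
  have idem: "E i * E i = E i" if i: "i < n" for i
  proof -
    \<comment> \<open>Since \<open>E i\<close> fixes \<open>x i\<close>, the element
      \<open>1 - E i\<close> annihilates it. Applying \<open>ann\<close> to this relation yields the
      idempotence of \<open>E i\<close>.\<close>
    let ?c = "\<lambda>k. if k = i then 1 - E i else 0"
    have "(\<Sum>k<n. s (?c k) (x k)) = (\<Sum>k<n. if k = i then s (1 - E i) (x i) else 0)"
      by (rule sum.cong) auto
    also have "\<dots> = 0" using i by (simp add: m1.scale_left_diff_distrib E)
    finally have "?c i * E i = 0" using ann[of ?c i] i by blast
    then show ?thesis by (simp add: algebra_simps)
  qed
  have Ey: "pm_scale (E i) (y i) = 0" if "i < n" for i
    by (rule poly_mapping_eqI)
      (use idem[OF that] in \<open>auto simp: y_def lookup_single when_def algebra_simps\<close>)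
  \<comment> \<open>The first coordinate of the relation gives \<open>c i * E i = 0\<close> by
    \<open>ann\<close>, and the coefficient at \<open>i\<close> of the second gives
    \<open>c i * (1 - E i) = 0\<close>. Their sum is \<open>c i\<close>.\<close>
  have indep: "c i = 0" if "(\<Sum>i<length bs. scale (c i) (bs ! i)) = 0" "i < length bs" for c i
  proof -
    have "(\<Sum>i<n. scale (c i) (x i, y i)) = 0"
      using that(1) by (simp add: len nth)
    then have "(\<Sum>i<n. s (c i) (x i)) = 0" and snd: "(\<Sum>i<n. pm_scale (c i) (y i)) = 0"
      by (auto simp: prod_eq_iff fst_sum snd_sum scale_def)
    then have "c i * E i = 0" using ann that(2) len by blast
    moreover have "(\<Sum>k<n. if k = i then c i * (1 - E i) else 0) = Poly_Mapping.lookup (\<Sum>i<n. pm_scale (c i) (y i)) i"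
      unfolding lookup_sum by (rule sum.cong) (auto simp: y_def lookup_single when_def)
    then have "c i * (1 - E i) = 0" using snd that(2) len by simp
    ultimately show ?thesis by (simp add: algebra_simps)
  qed
  have b_span: "(x i, y i) \<in> p.span (set bs)" if "i < n" for i
    using that by (intro p.span_base) (auto simp: bs_def)
  have span: "p.span (set bs) = M \<times> N"
  proof
    have "p.subspace (M \<times> N)"
      unfolding M[symmetric] N_def by (intro subspace_Times m1.subspace_span m2.subspace_span)
    moreover have "set bs \<subseteq> M \<times> N"
      unfolding M[symmetric] N_def by (auto simp: bs_def intro: m1.span_base m2.span_base)
    ultimately show "p.span (set bs) \<subseteq> M \<times> N" by (rule p.span_minimal[rotated])
    \<comment> \<open>Multiplication by \<open>E i\<close> and by \<open>1 - E i\<close> separates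
      the two coordinates of a basis pair, so both summands lie in the span.\<close>
    have "(x i, 0) = scale (E i) (x i, y i)" "(0, y i) = scale (1 - E i) (x i, y i)" if "i < n" for i
      using E[OF that] Ey[OF that]
      by (simp_all add: scale_def m1.scale_left_diff_distrib m2.scale_left_diff_distrib)
    then have b: "(x i, 0) \<in> p.span (set bs)" "(0, y i) \<in> p.span (set bs)" if "i < n" for i
      using b_span[OF that] p.span_scale that by metis+
    have "m1.span (x ` {..<n}) \<subseteq> {z. (z, 0) \<in> p.span (set bs)}"
    proof (rule m1.span_minimal)
      show "x ` {..<n} \<subseteq> {z. (z, 0) \<in> p.span (set bs)}" using b by auto
      show "m1.subspace {z. (z, 0) \<in> p.span (set bs)}"
      proof (rule m1.subspaceI; clarify)
        show "(0, 0) \<in> p.span (set bs)" using p.span_zero by (simp add: zero_prod_def)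
        show "(u + w, 0) \<in> p.span (set bs)" if "(u, 0) \<in> p.span (set bs)" "(w, 0) \<in> p.span (set bs)" for u w
          using p.span_add[OF that] by simp
        show "(s c u, 0) \<in> p.span (set bs)" if "(u, 0) \<in> p.span (set bs)" for c u
          using p.span_scale[OF that, of c] by (simp add: scale_def)
      qed
    qed
    moreover have "m2.span (y ` {..<n}) \<subseteq> {z. (0, z) \<in> p.span (set bs)}"
    proof (rule m2.span_minimal)
      show "y ` {..<n} \<subseteq> {z. (0, z) \<in> p.span (set bs)}" using b by auto
      show "m2.subspace {z. (0, z) \<in> p.span (set bs)}"
      proof (rule m2.subspaceI; clarify)
        show "(0, 0) \<in> p.span (set bs)" using p.span_zero by (simp add: zero_prod_def)
        show "(0, u + w) \<in> p.span (set bs)" if "(0, u) \<in> p.span (set bs)" "(0, w) \<in> p.span (set bs)" for u w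
          using p.span_add[OF that] by simp
        show "(0, pm_scale c u) \<in> p.span (set bs)" if "(0, u) \<in> p.span (set bs)" for c u
          using p.span_scale[OF that, of c] by (simp add: scale_def)
      qed
    qed
    ultimately have "(z, 0) + (0, w) \<in> p.span (set bs)" if "z \<in> M" "w \<in> N" for z w
      using that unfolding M N_def by (intro p.span_add) auto
    then show "M \<times> N \<subseteq> p.span (set bs)" by auto
  qed
  \<comment> \<open>On the first coordinate the factor \<open>E i\<close> acts as 1 and
    \<open>1 - E i\<close> as 0, which leaves \<open>f (x j)\<close>. On the second the roles are
    exchanged, and only the diagonal term \<open>y j\<close> survives.\<close>
  have "represents scale bs bs (map_prod f id) ?B"
    unfolding represents_def len
  proof (intro conjI allI impI)
    fix j assume j: "j < n"
    have "(\<Sum>i<n. s (?B $$ (i, j)) (x i)) = f (x j)"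
      unfolding fx[OF j]
    proof (rule sum.cong[OF refl])
      fix i assume "i \<in> {..<n}"
      then have i: "i < n" by simp
      have "s (E i * a i j) (x i) = s (a i j) (x i)"
        using E[OF i] by (metis m1.scale_scale mult.commute)
      then show "s (?B $$ (i, j)) (x i) = s (a i j) (x i)"
        using i j E[OF i] by (auto simp: m1.scale_left_distrib m1.scale_left_diff_distrib)
    qed
    moreover have "(\<Sum>i<n. pm_scale (?B $$ (i, j)) (y i)) = (\<Sum>i<n. if i = j then y j else 0)"
    proof (rule sum.cong[OF refl])
      fix i assume "i \<in> {..<n}"
      then have i: "i < n" by simp
      have "pm_scale (E i * a i j) (y i) = 0"
        using Ey[OF i] by (metis m2.scale_scale mult.commute m2.scale_zero_right)
      then show "pm_scale (?B $$ (i, j)) (y i) = (if i = j then y j else 0)"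
        using i j Ey[OF i] by (auto simp: m2.scale_left_distrib m2.scale_left_diff_distrib)
    qed
    ultimately show "map_prod f id (bs ! j) = (\<Sum>i<n. scale (?B $$ (i, j)) (bs ! i))"
      using j by (simp add: nth prod_eq_iff fst_sum snd_sum scale_def)
  qed auto
  moreover have "distinct bs" "p.independent (set bs)"
    by (rule p.independent_listI, use indep in blast)+
  ultimately have "is_endo_det s M N f (det ?B)"
    unfolding is_endo_det_altdef using span by blast
  then show ?thesis
    by (intro endo_det_eqI[OF s f]) (simp_all add: N_def m2.subspace_span)
qed

section \<open>Deleting unit columns\<close>

text \<open>Each element of \<open>K\<close> is \<open>pick K\<close> at its own rank, so the image
  of \<open>{..<card K}\<close> contains \<open>K\<close>. Counting then forces equality and
  injectivity.\<close>

lemma bij_betw_pick: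
  assumes "finite K"
  shows "bij_betw (pick K) {..<card K} K"
proof -
  have "i \<in> pick K ` {..<card K}" if "i \<in> K" for i
  proof
    show "i = pick K (card {a \<in> K. a < i})" using pick_card_in_set[OF that] by simp
    have "{a \<in> K. a < i} \<subset> K" using that by auto
    then show "card {a \<in> K. a < i} \<in> {..<card K}" using assms by (simp add: psubset_card_mono)
  qed
  then have sub: "K \<subseteq> pick K ` {..<card K}" by blast
  moreover have le: "card (pick K ` {..<card K}) \<le> card K"
    using card_image_le[of "{..<card K}" "pick K"] by simp
  ultimately have eq: "pick K ` {..<card K} = K"
    using card_seteq[OF _ sub] by auto
  then have "inj_on (pick K) {..<card K}"
    by (intro eq_card_imp_inj_on) auto
  with eq show ?thesis by (simp add: bij_betw_def)
qed

text \<open>\<open>A - 1\<close> vanishes in the columns outside \<open>K\<close>. So it is the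
  product of its columns in \<open>K\<close>, which form \<open>W\<close>, with the coordinate
  projection \<open>P\<close> to \<open>K\<close>; in the other order the product is the block of
  \<open>A - 1\<close> on \<open>K\<close>.\<close>

lemma det_unit_columns:
  fixes A :: "'a::comm_ring_1 mat"
  assumes A: "A \<in> carrier_mat n n" and K: "K \<subseteq> {..<n}"
    and unit: "\<And>i j. i < n \<Longrightarrow> j < n \<Longrightarrow> j \<notin> K \<Longrightarrow> A $$ (i, j) = (if i = j then 1 else 0)"
  shows "det A = det (mat (card K) (card K) (\<lambda>(a, b). A $$ (pick K a, pick K b)))"
proof -
  have fin: "finite K" using K finite_subset by blast
  note bij = bij_betw_pick[OF fin]
  have pick: "pick K a \<in> K" "pick K a < n" if "a < card K" for a
    using bij that K by (auto simp: bij_betw_def)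
  have inj: "pick K a = pick K b \<longleftrightarrow> a = b" if "a < card K" "b < card K" for a b
    using bij that by (auto simp: bij_betw_def inj_on_def)
  define W where "W = mat n (card K) (\<lambda>(i, a). (A - 1\<^sub>m n) $$ (i, pick K a))"
  define P where "P = mat (card K) n (\<lambda>(a, j). if j = pick K a then 1 else (0::'a))"
  have W: "W \<in> carrier_mat n (card K)" and P: "P \<in> carrier_mat (card K) n"
    by (auto simp: W_def P_def)
  have "1\<^sub>m n + W * P = A"
  proof (rule eq_matI)
    fix i j assume "i < dim_row A" "j < dim_col A"
    then have ij: "i < n" "j < n" using A by auto
    have "(W * P) $$ (i, j) = (\<Sum>a<card K. (A - 1\<^sub>m n) $$ (i, pick K a) * (if j = pick K a then 1 else 0))"
      using ij by (simp add: W_def P_def scalar_prod_def atLeast0LessThan)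
    also have "\<dots> = (\<Sum>k\<in>K. (A - 1\<^sub>m n) $$ (i, k) * (if j = k then 1 else 0))"
      by (rule sum.reindex_bij_betw[OF bij])
    also have "\<dots> = (\<Sum>k\<in>K. if k = j then (A - 1\<^sub>m n) $$ (i, j) else 0)"
      by (rule sum.cong) auto
    also have "\<dots> = (A - 1\<^sub>m n) $$ (i, j)"
      using fin unit[OF ij] ij A by auto
    finally show "(1\<^sub>m n + W * P) $$ (i, j) = A $$ (i, j)"
      using ij A W P by simp
  qed (use A W P in auto)
  moreover have "1\<^sub>m (card K) + P * W = mat (card K) (card K) (\<lambda>(a, b). A $$ (pick K a, pick K b))"
  proof (rule eq_matI, goal_cases)
    case (1 a b)
    then have ab: "a < card K" "b < card K" by auto
    have "(P * W) $$ (a, b) = (\<Sum>i<n. (if i = pick K a then 1 else 0) * (A - 1\<^sub>m n) $$ (i, pick K b))"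
      using ab by (simp add: W_def P_def scalar_prod_def atLeast0LessThan)
    also have "\<dots> = (\<Sum>i<n. if i = pick K a then (A - 1\<^sub>m n) $$ (pick K a, pick K b) else 0)"
      by (rule sum.cong) auto
    also have "\<dots> = A $$ (pick K a, pick K b) - (if a = b then 1 else 0)"
      using pick ab A inj by simp
    finally show ?case using ab W P by simp
  qed (use W P in auto)
  ultimately show ?thesis
    using det_one_plus_mult_commute[OF W P] by simp
qed

text \<open>The scalar \<open>c\<close> is split off the columns outside \<open>K\<close> by a
  diagonal right factor. The remaining matrix has genuine unit columns there and the same block on
  \<open>K\<close>.\<close>

lemma det_scaled_unit_columns:
  fixes A :: "'a::comm_ring_1 mat"
  assumes A: "A \<in> carrier_mat n n" and K: "K \<subseteq> {..<n}"
    and unit: "\<And>i j. i < n \<Longrightarrow> j < n \<Longrightarrow> j \<notin> K \<Longrightarrow> A $$ (i, j) = (if i = j then c else 0)"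
  shows "det A = c ^ card ({..<n} - K) * det (mat (card K) (card K) (\<lambda>(a, b). A $$ (pick K a, pick K b)))"
proof -
  define A' where "A' = mat n n (\<lambda>(i, j). if j \<in> K then A $$ (i, j) else if i = j then 1 else 0)"
  define \<Delta> where "\<Delta> = mat n n (\<lambda>(i, j). if i = j then if j \<in> K then 1 else c else 0)"
  have A': "A' \<in> carrier_mat n n" and \<Delta>: "\<Delta> \<in> carrier_mat n n" by (auto simp: A'_def \<Delta>_def)
  have "A = A' * \<Delta>"
  proof (rule eq_matI)
    fix i j assume "i < dim_row (A' * \<Delta>)" "j < dim_col (A' * \<Delta>)"
    then have ij: "i < n" "j < n" using A' \<Delta> by auto
    have "(A' * \<Delta>) $$ (i, j) = (\<Sum>k<n. A' $$ (i, k) * \<Delta> $$ (k, j))"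
      using ij A' \<Delta> by (simp add: scalar_prod_def atLeast0LessThan)
    also have "\<dots> = (\<Sum>k<n. if k = j then A' $$ (i, j) * \<Delta> $$ (j, j) else 0)"
      by (rule sum.cong) (use ij in \<open>auto simp: \<Delta>_def\<close>)
    also have "\<dots> = A $$ (i, j)"
      using ij unit[OF ij] by (auto simp: A'_def \<Delta>_def)
    finally show "A $$ (i, j) = (A' * \<Delta>) $$ (i, j)" by simp
  qed (use A A' \<Delta> in auto)
  moreover have "det \<Delta> = c ^ card ({..<n} - K)"
  proof -
    have "det \<Delta> = prod_list (diag_mat \<Delta>)"
      by (rule det_upper_triangular[OF _ \<Delta>]) (auto simp: upper_triangular_def \<Delta>_def)
    also have "diag_mat \<Delta> = map (\<lambda>i. if i \<in> K then 1 else c) [0..<n]"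
      by (auto simp: diag_mat_def \<Delta>_def)
    also have "prod_list \<dots> = (\<Prod>i<n. if i \<in> K then 1 else c)"
      by (simp add: prod.list_conv_set_nth atLeast0LessThan)
    also have "\<dots> = (\<Prod>i\<in>{..<n} - K. c)"
      by (rule prod.mono_neutral_cong_right) auto
    finally show ?thesis by simp
  qed
  moreover have "det A' = det (mat (card K) (card K) (\<lambda>(a, b). A' $$ (pick K a, pick K b)))"
    by (rule det_unit_columns[OF A' K]) (auto simp: A'_def)
  moreover have "mat (card K) (card K) (\<lambda>(a, b). A' $$ (pick K a, pick K b))
      = mat (card K) (card K) (\<lambda>(a, b). A $$ (pick K a, pick K b))"
  proof -
    have "pick K a \<in> K" "pick K a < n" if "a < card K" for a
      using bij_betw_pick[of K] that K finite_subset[OF K] by (auto simp: bij_betw_def)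
    then show ?thesis by (intro eq_matI) (auto simp: A'_def)
  qed
  ultimately show ?thesis
    using det_mult[OF A' \<Delta>] by (simp add: mult.commute)
qed

text \<open>An entry of the matrix in \<open>ihara_det\<close> when \<open>C\<close> and
  \<open>D\<close> are diagonal, listed by powers of u. Right multiplication by a diagonal matrix
  scales columns, hence the index \<open>j\<close> in \<open>c j\<close>. Functions instead of
  matrices allow the same formula over every coefficient ring and for reindexed blocks.\<close>

definition ihara_entry :: "(nat \<Rightarrow> nat \<Rightarrow> 'r::comm_ring_1) \<Rightarrow> (nat \<Rightarrow> 'r) \<Rightarrow> (nat \<Rightarrow> 'r) \<Rightarrow> nat \<Rightarrow> nat \<Rightarrow> 'r poly" where
  "ihara_entry a c d i j =
     [:if i = j then 1 else 0, - (a i j * c j), if i = j then d j * c j - 1 else 0:]"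

text \<open>Serves both for \<open>xi\<close> and for the determinant of the trimmed
  matrices.\<close>

lemma ihara_det_diagonal:
  fixes A :: "'r::comm_ring_1 mat"
  assumes A: "A \<in> carrier_mat n n" and C: "C \<in> carrier_mat n n" and D: "D \<in> carrier_mat n n"
    and a: "\<And>i j. i < n \<Longrightarrow> j < n \<Longrightarrow> A $$ (i, j) = a i j"
    and c: "\<And>i j. i < n \<Longrightarrow> j < n \<Longrightarrow> C $$ (i, j) = (if i = j then c i else 0)"
    and d: "\<And>i j. i < n \<Longrightarrow> j < n \<Longrightarrow> D $$ (i, j) = (if i = j then d i else 0)"
  shows "ihara_det n A C D = det (mat n n (\<lambda>(i, j). ihara_entry a c d i j))"
proof -
  have mult: "(B * C) $$ (i, j) = B $$ (i, j) * c j" if B: "B \<in> carrier_mat n n" and ij: "i < n" "j < n" for B i j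
  proof -
    have "(B * C) $$ (i, j) = (\<Sum>k<n. B $$ (i, k) * C $$ (k, j))"
      using B C ij by (simp add: scalar_prod_def atLeast0LessThan)
    also have "\<dots> = (\<Sum>k<n. if k = j then B $$ (i, j) * c j else 0)"
      by (rule sum.cong) (use ij c in auto)
    finally show ?thesis using ij by simp
  qed
  have AC: "A * C \<in> carrier_mat n n" and DC: "D * C \<in> carrier_mat n n" using A C D by auto
  show ?thesis
    unfolding ihara_det_def
  proof (rule arg_cong[of _ _ det], rule eq_matI, goal_cases)
    case (1 i j)
    then have ij: "i < n" "j < n" by auto
    then show ?case
      using AC DC A C D mult[OF A ij] mult[OF D ij]
      by (auto simp: ihara_entry_def a d power2_eq_square one_pCons)
  qed (use AC DC in auto)
qed

lemma map_poly_ihara_entry: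
  assumes "comm_ring_hom h"
  shows "map_poly h (ihara_entry a c d i j) = ihara_entry (\<lambda>i j. h (a i j)) (\<lambda>j. h (c j)) (\<lambda>j. h (d j)) i j"
proof -
  interpret comm_ring_hom h by fact
  show ?thesis
    by (rule poly_eqI)
      (auto simp: ihara_entry_def coeff_map_poly coeff_pCons hom_distribs split: nat.splits)
qed

section \<open>Characters\<close>

text \<open>Summation over the whole finite group has an index set independent of \<open>x\<close>,
  which makes additivity immediate.\<close>

lemma char_ext_altdef:
  fixes \<psi> :: "'g::finite \<Rightarrow> complex"
  shows "char_ext \<psi> x = (\<Sum>a\<in>UNIV. Poly_Mapping.lookup x a * \<psi> a)"
  unfolding char_ext_def by (rule sum.mono_neutral_left) (auto simp: in_keys_iff)

lemma char_ext_int_altdef: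
  fixes \<psi> :: "'g::finite \<Rightarrow> complex"
  shows "char_ext_int \<psi> x = (\<Sum>a\<in>UNIV. of_int (Poly_Mapping.lookup x a) * \<psi> a)"
  by (simp add: char_ext_int_def char_ext_altdef Poly_Mapping.map.rep_eq when_def)
    (rule sum.cong; auto)

lemma char_ext_single:
  fixes \<psi> :: "'g::finite \<Rightarrow> complex"
  shows "char_ext \<psi> (Poly_Mapping.single a c) = c * \<psi> a"
proof -
  have "char_ext \<psi> (Poly_Mapping.single a c) = (\<Sum>b\<in>UNIV. if b = a then c * \<psi> a else 0)"
    unfolding char_ext_altdef by (rule sum.cong) (auto simp: lookup_single)
  then show ?thesis by simp
qed

lemma char_ext_int_single:
  fixes \<psi> :: "'g::finite \<Rightarrow> complex"
  shows "char_ext_int \<psi> (Poly_Mapping.single a c) = of_int c * \<psi> a"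
proof -
  have "char_ext_int \<psi> (Poly_Mapping.single a c) = (\<Sum>b\<in>UNIV. if b = a then of_int c * \<psi> a else 0)"
    unfolding char_ext_int_altdef by (rule sum.cong) (auto simp: lookup_single)
  then show ?thesis by simp
qed

lemma is_character_0:
  assumes "is_character \<psi>"
  shows "\<psi> 0 = 1"
  using assms by (metis add_0 is_character_def mult_cancel_left2)

text \<open>Both sides of the product rule are additive in each factor, so it only has to be checked
  on multiples of group elements, where it is the multiplicativity of \<open>\<psi>\<close>.\<close>

lemma comm_ring_hom_char_ext:
  fixes \<psi> :: "'g::{finite, ab_group_add} \<Rightarrow> complex"
  assumes \<psi>: "is_character \<psi>"
  shows "comm_ring_hom (char_ext \<psi>)"
proof
  have add: "char_ext \<psi> (x + y) = char_ext \<psi> x + char_ext \<psi> y" for x y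
    by (simp add: char_ext_altdef lookup_add distrib_right sum.distrib)
  then show "char_ext \<psi> (x + y) = char_ext \<psi> x + char_ext \<psi> y" for x y .
  show "char_ext \<psi> 0 = 0" by (simp add: char_ext_altdef)
  show "char_ext \<psi> 1 = 1"
    using char_ext_single[of \<psi> 0 1] is_character_0[OF \<psi>] by simp
  show "char_ext \<psi> (x * y) = char_ext \<psi> x * char_ext \<psi> y" for x y
  proof (induction x rule: poly_mapping_single_induct)
    case (single k v)
    show ?case
      by (induction y rule: poly_mapping_single_induct)
        (use \<psi> in \<open>simp_all add: mult_single char_ext_single distrib_left add is_character_def\<close>)
  qed (simp add: distrib_right add)
qed

lemma comm_ring_hom_char_ext_int:
  fixes \<psi> :: "'g::{finite, ab_group_add} \<Rightarrow> complex"
  assumes \<psi>: "is_character \<psi>"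
  shows "comm_ring_hom (char_ext_int \<psi>)"
proof
  have add: "char_ext_int \<psi> (x + y) = char_ext_int \<psi> x + char_ext_int \<psi> y" for x y
    by (simp add: char_ext_int_altdef lookup_add distrib_right sum.distrib)
  then show "char_ext_int \<psi> (x + y) = char_ext_int \<psi> x + char_ext_int \<psi> y" for x y .
  show "char_ext_int \<psi> 0 = 0" by (simp add: char_ext_int_altdef)
  show "char_ext_int \<psi> 1 = 1"
    using char_ext_int_single[of \<psi> 0 1] is_character_0[OF \<psi>] by simp
  show "char_ext_int \<psi> (x * y) = char_ext_int \<psi> x * char_ext_int \<psi> y" for x y
  proof (induction x rule: poly_mapping_single_induct)
    case (single k v)
    show ?case
      by (induction y rule: poly_mapping_single_induct)
        (use \<psi> in \<open>simp_all add: mult_single char_ext_int_single distrib_left add is_character_def\<close>)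
  qed (simp add: distrib_right add)
qed

text \<open>If some \<open>b\<close> in \<open>S\<close> has \<open>\<psi> b \<noteq> 1\<close>,
  translation by \<open>b\<close> permutes \<open>S\<close> and multiplies the sum by
  \<open>\<psi> b\<close>, so the sum is 0.\<close>

lemma sum_character_subgroup:
  fixes \<psi> :: "'g::{finite, ab_group_add} \<Rightarrow> complex"
  assumes \<psi>: "is_character \<psi>" and S: "is_subgroup S"
  shows "(\<Sum>a\<in>S. \<psi> a) = (if S \<subseteq> char_ker \<psi> then of_nat (card S) else 0)"
proof (cases "S \<subseteq> char_ker \<psi>")
  case True
  then have "(\<Sum>a\<in>S. \<psi> a) = (\<Sum>a\<in>S. 1)"
    by (intro sum.cong) (auto simp: char_ker_def)
  then show ?thesis using True by simp
next
  case False
  then obtain b where b: "b \<in> S" "\<psi> b \<noteq> 1" by (auto simp: char_ker_def)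
  have "b + (a - b) = a" "a - b \<in> S" "b + a \<in> S" if "a \<in> S" for a
    using S b that unfolding is_subgroup_def by (auto simp: diff_conv_add_uminus simp del: add_uminus_conv_diff)
  then have "(\<Sum>a\<in>S. \<psi> a) = (\<Sum>a\<in>S. \<psi> (b + a))"
    by (intro sum.reindex_bij_witness[of _ "\<lambda>a. b + a" "\<lambda>a. a - b"]) auto
  also have "\<dots> = \<psi> b * (\<Sum>a\<in>S. \<psi> a)"
    using \<psi> by (simp add: is_character_def sum_distrib_left)
  finally have "(\<Sum>a\<in>S. \<psi> a) = 0" using b(2) by simp
  then show ?thesis using False by simp
qed

section \<open>Linearity of the operators\<close>

lemma coeff_poly_scale_const:
  assumes "Modules.module s"
  shows "Polynomial.coeff (poly_scale s p [:x:]) n = s (Polynomial.coeff p n) x"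
proof -
  interpret s: Modules.module s by fact
  have "Polynomial.coeff (poly_scale s p [:x:]) n = (\<Sum>i\<le>n. if i = n then s (Polynomial.coeff p n) x else 0)"
    unfolding coeff_poly_scale[OF assms]
    by (rule sum.cong) (auto simp: coeff_pCons split: nat.splits)
  then show ?thesis by simp
qed

lemma module_hom_map_poly:
  assumes "module_hom s s L"
  shows "module_hom (poly_scale s) (poly_scale s) (map_poly L)"
proof -
  interpret L: module_hom s s L by fact
  have s: "Modules.module s" by unfold_locales
  interpret Modules.module "poly_scale s" by (rule module_poly_scale[OF s])
  show ?thesis
    by unfold_locales
      (auto intro!: poly_eqI simp: coeff_map_poly coeff_poly_scale[OF s] L.add L.sum L.scale)
qed

text \<open>Multiplication by u shifts the convolution of coefficients by one index. The extra term
  that appears contains the constant coefficient of \<open>pCons 0 q\<close>, which is 0.\<close>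

lemma module_hom_pCons_0:
  assumes s: "Modules.module s"
  shows "module_hom (poly_scale s) (poly_scale s) (pCons 0)"
proof -
  interpret s: Modules.module s by fact
  interpret Modules.module "poly_scale s" by (rule module_poly_scale[OF s])
  show ?thesis
  proof unfold_locales
    fix p q
    show "pCons 0 (poly_scale s p q) = poly_scale s p (pCons 0 q)"
    proof (rule poly_eqI)
      fix n
      have "(\<Sum>i\<le>k. s (Polynomial.coeff p i) (Polynomial.coeff (pCons 0 q) (Suc k - i)))
          = (\<Sum>i\<le>k. s (Polynomial.coeff p i) (Polynomial.coeff q (k - i)))" for k
        by (rule sum.cong) (auto simp: Suc_diff_le)
      then show "Polynomial.coeff (pCons 0 (poly_scale s p q)) n = Polynomial.coeff (poly_scale s p (pCons 0 q)) n"
        by (cases n) (simp_all add: coeff_poly_scale[OF s])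
    qed
  qed simp
qed

section \<open>Complex-linear extensions and their linearity over the group ring\<close>

lemma lin_ext_superset:
  assumes "finite T" "Poly_Mapping.keys x \<subseteq> T"
  shows "lin_ext F x = (\<Sum>w\<in>T. pm_scale (Poly_Mapping.lookup x w) (F w))"
proof -
  interpret Modules.module pm_scale by (rule module_pm_scale)
  show ?thesis
    unfolding lin_ext_def by (rule sum.mono_neutral_left) (use assms in \<open>auto simp: in_keys_iff\<close>)
qed

lemma lin_ext_add: "lin_ext F (x + y) = lin_ext F x + lin_ext F y"
proof -
  interpret Modules.module pm_scale by (rule module_pm_scale)
  let ?T = "Poly_Mapping.keys x \<union> Poly_Mapping.keys y"
  have *: "Poly_Mapping.keys (x + y) \<subseteq> ?T" by (rule Poly_Mapping.keys_add)
  show ?thesis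
    by (subst (1 2 3) lin_ext_superset[of ?T])
      (use * in \<open>auto simp: lookup_add scale_left_distrib sum.distrib\<close>)
qed

lemma lin_ext_single: "lin_ext F (Poly_Mapping.single w c) = pm_scale c (F w)"
  by (subst lin_ext_superset[of "{w}"]) auto

lemma pm_scale_single: "pm_scale c (Poly_Mapping.single w d) = Poly_Mapping.single w (c * d)"
  by (rule poly_mapping_eqI) (simp add: lookup_single when_def)

lemma group_ring_scale_pm_scale:
  fixes x :: "'w \<Rightarrow>\<^sub>0 complex"
  shows "group_ring_scale act (Poly_Mapping.single \<tau> c) (pm_scale d x) =
     pm_scale (c * d) (group_ring_scale act (Poly_Mapping.single \<tau> 1) x)"
proof -
  interpret Modules.module "pm_scale :: complex \<Rightarrow> ('w \<Rightarrow>\<^sub>0 complex) \<Rightarrow> _" by (rule module_pm_scale)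
  show ?thesis
    by (induction x rule: poly_mapping_single_induct)
      (simp_all add: pm_scale_single group_ring_scale_single scale_right_distrib
        group_ring_scale_add_right mult.assoc)
qed

text \<open>Equivariance on basis vectors suffices: both sides are additive in \<open>a\<close> and
  in \<open>x\<close>, so only multiples of single group elements and single vertices have to be
  compared.\<close>

lemma module_hom_lin_ext:
  fixes act :: "'g::ab_group_add \<Rightarrow> 'w \<Rightarrow> 'w"
  assumes act: "\<And>w. act 0 w = w" "\<And>a b w. act (a + b) w = act a (act b w)"
    and F: "\<And>\<tau> w. F (act \<tau> w) = group_ring_scale act (Poly_Mapping.single \<tau> 1) (F w)"
  shows "module_hom (group_ring_scale act) (group_ring_scale act) (lin_ext F)"
proof -
  interpret Modules.module "group_ring_scale act" by (rule module_group_ring_scale[OF act])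
  show ?thesis
  proof unfold_locales
    fix a x
    show "lin_ext F (group_ring_scale act a x) = group_ring_scale act a (lin_ext F x)"
    proof (induction a rule: poly_mapping_single_induct)
      case (single \<tau> c)
      show ?case
        by (induction x rule: poly_mapping_single_induct)
          (simp_all add: group_ring_scale_single lin_ext_single F group_ring_scale_pm_scale
            lin_ext_add group_ring_scale_add_right)
    qed (simp add: lin_ext_add group_ring_scale_add_left)
  qed (rule lin_ext_add)
qed

section \<open>Cosets, and the edges of the derived graph under translation\<close>

lemma coset_cancel: "coset \<tau> S = coset \<tau> T \<longleftrightarrow> S = T"
  unfolding coset_def by (simp add: inj_image_eq_iff)

lemma coset_eq_iff:
  assumes "is_subgroup S"
  shows "coset \<tau> S = coset \<sigma> S \<longleftrightarrow> \<sigma> - \<tau> \<in> S"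
proof
  assume eq: "coset \<tau> S = coset \<sigma> S"
  have "\<sigma> + 0 \<in> coset \<sigma> S" using assms unfolding coset_def is_subgroup_def by blast
  then have "\<sigma> \<in> coset \<tau> S" using eq by simp
  then obtain b where "b \<in> S" "\<sigma> = \<tau> + b" unfolding coset_def by auto
  then show "\<sigma> - \<tau> \<in> S" by simp
next
  assume d: "\<sigma> - \<tau> \<in> S"
  have "\<tau> + b \<in> coset \<sigma> S" if "b \<in> S" for b
  proof -
    have "- (\<sigma> - \<tau>) + b \<in> S" using assms d that unfolding is_subgroup_def by blast
    then have "\<sigma> + (- (\<sigma> - \<tau>) + b) \<in> coset \<sigma> S" unfolding coset_def by blast
    then show ?thesis by (simp add: algebra_simps)
  qed
  moreover have "\<sigma> + b \<in> coset \<tau> S" if "b \<in> S" for b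
  proof -
    have "(\<sigma> - \<tau>) + b \<in> S" using assms d that unfolding is_subgroup_def by blast
    then have "\<tau> + ((\<sigma> - \<tau>) + b) \<in> coset \<tau> S" unfolding coset_def by blast
    then show ?thesis by (simp add: algebra_simps)
  qed
  ultimately show "coset \<tau> S = coset \<sigma> S" by (auto simp: coset_def)
qed

lemma coset_eq_self_iff:
  assumes "is_subgroup S"
  shows "coset \<tau> S = S \<longleftrightarrow> \<tau> \<in> S"
  using coset_eq_iff[OF assms, of 0 \<tau>] by (auto simp: coset_0)

lemma module_vertex_act: "Modules.module (group_ring_scale vertex_act)"
  by (rule module_group_ring_scale[OF vertex_act_0 vertex_act_add])

definition edges_from :: "('v, 'e) sgraph \<Rightarrow> 'v \<Rightarrow> 'e set" where
  "edges_from X w = {e \<in> dedges X. orig X e = w}"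

lemma edges_from_derived_graph:
  "edges_from (derived_graph X H \<alpha>) (w, S) = {(s, \<sigma>). s \<in> edges_from X w \<and> coset \<sigma> (H w) = S}"
  by (auto simp: edges_from_def derived_graph_def)

text \<open>Translation of the second coordinate is inverted by the opposite translation. The claim
  covers every pair \<open>w\<close>, vertex or not, because linearity of the operators is stated on
  the whole ambient module. It yields equivariance of both the adjacency and the degree
  operator.\<close>

lemma bij_betw_edges_from_vertex_act:
  "bij_betw (\<lambda>(s, \<sigma>). (s, \<tau> + \<sigma>)) (edges_from (derived_graph X H \<alpha>) w)
     (edges_from (derived_graph X H \<alpha>) (vertex_act \<tau> w))"
proof (rule bij_betw_byWitness[where f' = "\<lambda>(s, \<sigma>). (s, \<sigma> - \<tau>)"])
  obtain w0 S where w: "w = (w0, S)" by (cases w)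
  have shift: "coset (\<sigma> - \<tau>) T = S" if "coset \<sigma> T = coset \<tau> S" for \<sigma> T
    using that coset_cancel[of \<tau> "coset (\<sigma> - \<tau>) T" S] by (simp add: coset_coset)
  show "(\<lambda>(s, \<sigma>). (s, \<tau> + \<sigma>)) ` edges_from (derived_graph X H \<alpha>) w
      \<subseteq> edges_from (derived_graph X H \<alpha>) (vertex_act \<tau> w)"
    by (auto simp: w vertex_act_def edges_from_derived_graph coset_coset)
  show "(\<lambda>(s, \<sigma>). (s, \<sigma> - \<tau>)) ` edges_from (derived_graph X H \<alpha>) (vertex_act \<tau> w)
      \<subseteq> edges_from (derived_graph X H \<alpha>) w"
    by (auto simp: w vertex_act_def edges_from_derived_graph shift)
qed auto

lemma termin_derived_graph_shift:
  "termin (derived_graph X H \<alpha>) (s, \<tau> + \<sigma>) = vertex_act \<tau> (termin (derived_graph X H \<alpha>) (s, \<sigma>))"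
  by (simp add: derived_graph_def vertex_act_def coset_coset add.assoc)

lemma module_hom_adj_op:
  "module_hom (group_ring_scale vertex_act) (group_ring_scale vertex_act) (adj_op (derived_graph X H \<alpha>))"
  unfolding adj_op_def edges_from_def[symmetric]
proof (rule module_hom_lin_ext[OF vertex_act_0 vertex_act_add])
  fix \<tau> w
  let ?Y = "derived_graph X H \<alpha>"
  interpret m: Modules.module "group_ring_scale vertex_act" by (rule module_vertex_act)
  have "(\<Sum>e\<in>edges_from ?Y (vertex_act \<tau> w). Poly_Mapping.single (termin ?Y e) (1::complex))
      = (\<Sum>e\<in>edges_from ?Y w. Poly_Mapping.single (termin ?Y (case e of (s, \<sigma>) \<Rightarrow> (s, \<tau> + \<sigma>))) 1)"
    by (rule sum.reindex_bij_betw[OF bij_betw_edges_from_vertex_act, symmetric])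
  also have "\<dots> = (\<Sum>e\<in>edges_from ?Y w. Poly_Mapping.single (vertex_act \<tau> (termin ?Y e)) 1)"
    by (rule sum.cong) (auto simp: termin_derived_graph_shift)
  finally show "(\<Sum>e\<in>edges_from ?Y (vertex_act \<tau> w). Poly_Mapping.single (termin ?Y e) (1::complex))
      = group_ring_scale vertex_act (Poly_Mapping.single \<tau> 1) (\<Sum>e\<in>edges_from ?Y w. Poly_Mapping.single (termin ?Y e) 1)"
    by (simp add: m.scale_sum_right group_ring_scale_single)
qed

lemma module_hom_deg_op:
  "module_hom (group_ring_scale vertex_act) (group_ring_scale vertex_act) (deg_op (derived_graph X H \<alpha>))"
  unfolding deg_op_def
proof (rule module_hom_lin_ext[OF vertex_act_0 vertex_act_add])
  fix \<tau> w
  have "val (derived_graph X H \<alpha>) (vertex_act \<tau> w) = val (derived_graph X H \<alpha>) w"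
    unfolding val_def edges_from_def[symmetric]
    using bij_betw_same_card[OF bij_betw_edges_from_vertex_act] by metis
  then show "Poly_Mapping.single (vertex_act \<tau> w) (of_nat (val (derived_graph X H \<alpha>) (vertex_act \<tau> w)))
    = group_ring_scale vertex_act (Poly_Mapping.single \<tau> 1) (Poly_Mapping.single w (of_nat (val (derived_graph X H \<alpha>) w)))"
    by (simp add: group_ring_scale_single)
qed

lemma module_hom_ihara_op:
  fixes X :: "('v, 'e) sgraph" and H :: "'v \<Rightarrow> 'g::ab_group_add set"
  shows "module_hom (poly_scale (group_ring_scale vertex_act)) (poly_scale (group_ring_scale vertex_act))
     (ihara_op (derived_graph X H \<alpha>))"
proof -
  let ?s = "group_ring_scale (vertex_act :: 'g \<Rightarrow> 'v \<times> 'g set \<Rightarrow> _)"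
  let ?Y = "derived_graph X H \<alpha>"
  interpret m: Modules.module ?s by (rule module_vertex_act)
  interpret p: Modules.module "poly_scale ?s" by (rule module_poly_scale[OF module_vertex_act])
  interpret m: module_pair ?s ?s by unfold_locales
  interpret p: module_pair "poly_scale ?s" "poly_scale ?s" by unfold_locales
  have pC: "module_hom (poly_scale ?s) (poly_scale ?s) (\<lambda>q. pCons 0 (h q))"
    if "module_hom (poly_scale ?s) (poly_scale ?s) h" for h
    using module_hom_compose[OF that module_hom_pCons_0[OF module_vertex_act]] by (simp add: comp_def)
  have adj: "module_hom (poly_scale ?s) (poly_scale ?s) (\<lambda>q. pCons 0 (map_poly (adj_op ?Y) q))"
    by (rule pC[OF module_hom_map_poly[OF module_hom_adj_op]])
  have "module_hom ?s ?s (\<lambda>x. deg_op ?Y x - x)"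
    by (rule m.module_hom_sub[OF module_hom_deg_op m.module_hom_ident])
  note deg = pC[OF pC[OF module_hom_map_poly[OF this]]]
  show ?thesis
    unfolding ihara_op_def[abs_def]
    by (rule p.module_hom_add[OF p.module_hom_sub[OF p.module_hom_ident adj] deg])
qed

section \<open>The determinant of the operator on the derived graph\<close>

definition average :: "'g set \<Rightarrow> ('g \<Rightarrow>\<^sub>0 complex)" where
  "average S = (\<Sum>a\<in>S. Poly_Mapping.single a (1 / of_nat (card S)))"

lemma is_subgroup_card_pos:
  fixes S :: "'g::{finite, ab_group_add} set"
  assumes "is_subgroup S"
  shows "card S > 0"
  using assms by (auto simp: is_subgroup_def card_gt_0_iff)

lemma average_fixes:
  fixes S :: "'g::{finite, ab_group_add} set"
  assumes "is_subgroup S"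
  shows "group_ring_scale vertex_act (average S) (Poly_Mapping.single (w, S) c) = Poly_Mapping.single (w, S) c"
proof -
  interpret m: Modules.module "group_ring_scale vertex_act" by (rule module_vertex_act)
  have "group_ring_scale vertex_act (average S) (Poly_Mapping.single (w, S) c)
      = (\<Sum>a\<in>S. Poly_Mapping.single (w, S) (c / of_nat (card S)))"
    unfolding average_def m.scale_sum_left
    by (rule sum.cong) (auto simp: group_ring_scale_single vertex_act_def coset_eq_self_iff[OF assms, THEN iffD2])
  also have "\<dots> = Poly_Mapping.single (w, S) c"
    using is_subgroup_card_pos[OF assms]
    by (intro poly_mapping_eqI) (auto simp: lookup_sum lookup_single when_def)
  finally show ?thesis .
qed

text \<open>Links the ideal generated by \<open>average S\<close> with the module spanned by the
  cosets of \<open>S\<close>: as a function on the group, \<open>a * average S\<close> is constant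
  on cosets, with values proportional to the coefficients of the translated vertex. So an
  \<open>a\<close> that annihilates the vertex also annihilates \<open>average S\<close>.\<close>

lemma lookup_mult_average:
  fixes S :: "'g::{finite, ab_group_add} set"
  assumes "is_subgroup S"
  shows "Poly_Mapping.lookup (a * average S) \<sigma> =
    Poly_Mapping.lookup (group_ring_scale vertex_act a (Poly_Mapping.single (w, S) 1)) (w, coset \<sigma> S) / of_nat (card S)"
proof (induction a rule: poly_mapping_single_induct)
  case (single \<tau> c)
  have "Poly_Mapping.lookup (Poly_Mapping.single \<tau> c * average S) \<sigma>
      = (\<Sum>b\<in>S. if b = \<sigma> - \<tau> then c / of_nat (card S) else 0)"
    unfolding average_def sum_distrib_left lookup_sum
    by (rule sum.cong) (auto simp: mult_single lookup_single when_def)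
  also have "\<dots> = (if \<sigma> - \<tau> \<in> S then c / of_nat (card S) else 0)" by simp
  finally show ?case
    by (simp add: group_ring_scale_single vertex_act_def lookup_single when_def coset_eq_iff[OF assms])
qed (simp add: distrib_right group_ring_scale_add_left lookup_add add_divide_distrib)

lemma lookup_group_ring_scale_other:
  assumes "w \<noteq> w'"
  shows "Poly_Mapping.lookup (group_ring_scale vertex_act a (Poly_Mapping.single (w, S) c)) (w', T) = 0"
  by (induction a rule: poly_mapping_single_induct)
    (use assms in \<open>simp_all add: group_ring_scale_single group_ring_scale_add_left vertex_act_def
      lookup_single lookup_add when_def\<close>)

section \<open>Generators of the module of the derived graph, one for each vertex of
  \<open>X\<close>\<close>

locale labelled_graph =
  fixes X :: "('v, 'e) sgraph"
    and g :: nat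
    and v :: "nat \<Rightarrow> 'v"
    and H :: "'v \<Rightarrow> 'g::{finite, ab_group_add} set"
    and \<alpha> :: "'e \<Rightarrow> 'g"
  assumes fin: "finite_graph X"
    and v: "bij_betw v {0..<g} (verts X)"
    and H: "\<And>w. w \<in> verts X \<Longrightarrow> is_subgroup (H w)"
begin

abbreviation Y :: "('v \<times> 'g set, 'e \<times> 'g) sgraph" where "Y \<equiv> derived_graph X H \<alpha>"
abbreviation S :: "('g \<Rightarrow>\<^sub>0 complex) \<Rightarrow> ('v \<times> 'g set \<Rightarrow>\<^sub>0 complex) \<Rightarrow> ('v \<times> 'g set \<Rightarrow>\<^sub>0 complex)" where
  "S \<equiv> group_ring_scale vertex_act"

text \<open>One representative per orbit: the vertices of \<open>Y\<close> above \<open>v i\<close>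
  are the translates of this one.\<close>

definition base_vertex :: "nat \<Rightarrow> 'v \<times> 'g set \<Rightarrow>\<^sub>0 complex" where
  "base_vertex i = Poly_Mapping.single (v i, H (v i)) 1"

text \<open>This and the next two definitions are the entries of \<open>A_mat\<close>,
  \<open>C_mat\<close> and \<open>D_mat\<close> with complex instead of integer coefficients, since
  \<open>eta\<close> lives over the complex group ring and \<open>xi\<close> over the integral
  one.\<close>

definition edge_sum :: "nat \<Rightarrow> nat \<Rightarrow> 'g \<Rightarrow>\<^sub>0 complex" where
  "edge_sum i j = (\<Sum>s\<in>{s \<in> dedges X. orig X s = v j \<and> termin X s = v i}. Poly_Mapping.single (\<alpha> s) 1)"

definition group_sum :: "nat \<Rightarrow> 'g \<Rightarrow>\<^sub>0 complex" where
  "group_sum j = (\<Sum>a\<in>H (v j). Poly_Mapping.single a 1)"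

definition degree_const :: "nat \<Rightarrow> 'g \<Rightarrow>\<^sub>0 complex" where
  "degree_const j = of_nat (val X (v j))"

lemma v_in_verts: "i < g \<Longrightarrow> v i \<in> verts X"
  using v by (auto simp: bij_betw_def)

lemma v_eq_iff: "i < g \<Longrightarrow> j < g \<Longrightarrow> v i = v j \<longleftrightarrow> i = j"
  using v by (auto simp: bij_betw_def inj_on_def)

lemma subgroup_v: "i < g \<Longrightarrow> is_subgroup (H (v i))"
  by (intro H v_in_verts)

text \<open>Translates of different generators lie above different vertices of \<open>X\<close>, so
  each term of the relation vanishes separately. \<open>lookup_mult_average\<close> then passes from
  the vertex to the idempotent.\<close>

lemma base_vertices_annihilator:
  assumes "(\<Sum>i<g. poly_scale S (c i) [:base_vertex i:]) = 0" "i < g"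
  shows "c i * [:average (H (v i)):] = 0"
proof (rule poly_eqI)
  fix n
  have "(\<Sum>k<g. S (Polynomial.coeff (c k) n) (base_vertex k)) = Polynomial.coeff (\<Sum>i<g. poly_scale S (c i) [:base_vertex i:]) n"
    by (simp add: Polynomial.coeff_sum coeff_poly_scale_const[OF module_vertex_act])
  then have sum0: "(\<Sum>k<g. S (Polynomial.coeff (c k) n) (base_vertex k)) = 0"
    by (simp add: assms(1))
  have "Polynomial.coeff (c i) n * average (H (v i)) = 0"
  proof (rule poly_mapping_eqI)
    fix \<sigma>
    let ?w = "(v i, coset \<sigma> (H (v i)))"
    have "0 = (\<Sum>k<g. Poly_Mapping.lookup (S (Polynomial.coeff (c k) n) (base_vertex k)) ?w)"
      using sum0 by (simp flip: lookup_sum)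
    also have "\<dots> = (\<Sum>k<g. if k = i then Poly_Mapping.lookup (S (Polynomial.coeff (c i) n) (base_vertex i)) ?w else 0)"
      by (rule sum.cong) (use assms(2) in \<open>auto simp: base_vertex_def lookup_group_ring_scale_other v_eq_iff\<close>)
    finally have "Poly_Mapping.lookup (S (Polynomial.coeff (c i) n) (base_vertex i)) ?w = 0"
      using assms(2) by simp
    then show "Poly_Mapping.lookup (Polynomial.coeff (c i) n * average (H (v i))) \<sigma> = Poly_Mapping.lookup 0 \<sigma>"
      by (simp add: lookup_mult_average[OF subgroup_v[OF assms(2)], of _ _ "v i"] base_vertex_def)
  qed
  then show "Polynomial.coeff (c i * [:average (H (v i)):]) n = Polynomial.coeff 0 n"
    by (simp add: mult.commute)
qed

lemma span_base_vertices:
  "module.span (poly_scale S) ((\<lambda>i. [:base_vertex i:]) ` {..<g}) = C0_poly Y"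
proof
  interpret p: Modules.module "poly_scale S" by (rule module_poly_scale[OF module_vertex_act])
  let ?U = "p.span ((\<lambda>i. [:base_vertex i:]) ` {..<g})"
  have "[:base_vertex i:] \<in> C0_poly Y" if "i < g" for i
  proof -
    have "(v i, coset 0 (H (v i))) \<in> verts Y"
      using v_in_verts[OF that] by (auto simp: derived_graph_def)
    then show ?thesis
      by (auto simp: C0_poly_def C0_def base_vertex_def coset_0 coeff_pCons split: nat.splits if_splits)
  qed
  then show "?U \<subseteq> C0_poly Y"
    by (intro p.span_minimal subspace_C0_poly vertex_act_in_verts vertex_act_0 vertex_act_add) auto
  have single: "Polynomial.monom (Poly_Mapping.single k c) n \<in> ?U" if k: "k \<in> verts Y" for k c n
  proof -
    obtain w \<sigma> where w: "w \<in> verts X" "k = (w, coset \<sigma> (H w))"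
      using k by (auto simp: derived_graph_def)
    obtain i where i: "i < g" "w = v i"
      using w(1) v unfolding bij_betw_def by (metis atLeastLessThan_iff imageE)
    \<comment> \<open>The vertex \<open>k\<close> is the translate by \<open>\<sigma>\<close> of the
      generator above \<open>w\<close>.\<close>
    have "Polynomial.monom (Poly_Mapping.single k c) n = poly_scale S (Polynomial.monom (Poly_Mapping.single \<sigma> c) n) [:base_vertex i:]"
      by (rule poly_eqI)
        (simp add: coeff_poly_scale_const[OF module_vertex_act] base_vertex_def group_ring_scale_single
          vertex_act_def w i module.scale_zero_left[OF module_vertex_act])
    then show ?thesis using i(1) by (auto intro: p.span_scale p.span_base)
  qed
  show "C0_poly Y \<subseteq> ?U"
  proof
    fix q assume q: "q \<in> C0_poly Y"
    have "Polynomial.monom (Polynomial.coeff q n) n \<in> ?U" for n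
    proof -
      let ?x = "Polynomial.coeff q n"
      have "?x = (\<Sum>k\<in>Poly_Mapping.keys ?x. Poly_Mapping.single k (Poly_Mapping.lookup ?x k))"
        by (rule poly_mapping_eqI) (auto simp: lookup_sum lookup_single when_def in_keys_iff)
      then have "Polynomial.monom ?x n
          = Polynomial.monom (\<Sum>k\<in>Poly_Mapping.keys ?x. Poly_Mapping.single k (Poly_Mapping.lookup ?x k)) n"
        by (rule arg_cong)
      moreover have "Poly_Mapping.keys ?x \<subseteq> verts Y" using q by (auto simp: C0_poly_def C0_def)
      ultimately show ?thesis
        unfolding monom_sum by (simp only:) (intro p.span_sum single, blast)
    qed
    then have "(\<Sum>n\<le>Polynomial.degree q. Polynomial.monom (Polynomial.coeff q n) n) \<in> ?U"
      by (intro p.span_sum)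
    then show "q \<in> ?U" by (simp add: poly_as_sum_of_monoms)
  qed
qed

section \<open>The operators on the generators\<close>

lemma edges_from_base:
  assumes "j < g"
  shows "edges_from Y (v j, H (v j)) = edges_from X (v j) \<times> H (v j)"
  by (auto simp: edges_from_derived_graph coset_eq_self_iff[OF subgroup_v[OF assms]])

text \<open>The edges leaving the base vertex are the pairs \<open>(s, a)\<close> with
  \<open>a\<close> in \<open>H (v j)\<close>, and such an edge ends at the translate by
  \<open>\<alpha> s + a\<close> of the base vertex above the end of \<open>s\<close>. Grouping them
  by that end produces the products \<open>edge_sum i j * group_sum j\<close>.\<close>

lemma adj_op_base_vertex:
  assumes j: "j < g"
  shows "adj_op Y (base_vertex j) = (\<Sum>i<g. S (edge_sum i j * group_sum j) (base_vertex i))"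
proof -
  interpret m: Modules.module S by (rule module_vertex_act)
  let ?E = "edges_from X (v j)"
  let ?h = "\<lambda>s. \<Sum>a\<in>H (v j). Poly_Mapping.single (termin X s, coset (\<alpha> s + a) (H (termin X s))) (1::complex)"
  have finE: "finite ?E" using fin by (simp add: edges_from_def finite_graph_def)
  have tE: "termin X ` ?E \<subseteq> verts X" and finV: "finite (verts X)"
    using fin by (auto simp: edges_from_def finite_graph_def serre_graph_def)
  have "S (edge_sum i j * group_sum j) (base_vertex i) = sum ?h {s \<in> ?E. termin X s = v i}" for i
  proof -
    have "edge_sum i j * group_sum j = (\<Sum>s\<in>{s \<in> ?E. termin X s = v i}. \<Sum>a\<in>H (v j). Poly_Mapping.single (\<alpha> s + a) 1)"
      by (simp add: edge_sum_def group_sum_def sum_product mult_single edges_from_def conj_assoc)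
    then show ?thesis
      by (simp add: m.scale_sum_left base_vertex_def group_ring_scale_single vertex_act_def)
  qed
  then have "(\<Sum>i<g. S (edge_sum i j * group_sum j) (base_vertex i)) = (\<Sum>i<g. sum ?h {s \<in> ?E. termin X s = v i})"
    by simp
  also have "\<dots> = (\<Sum>w\<in>verts X. sum ?h {s \<in> ?E. termin X s = w})"
    using sum.reindex_bij_betw[OF v, of "\<lambda>w. sum ?h {s \<in> ?E. termin X s = w}"] by (simp add: atLeast0LessThan)
  also have "\<dots> = sum ?h ?E"
    by (rule sum.group[OF finE finV tE])
  also have "\<dots> = (\<Sum>e\<in>?E \<times> H (v j). Poly_Mapping.single (termin Y e) 1)"
    unfolding sum.cartesian_product by (rule sum.cong) (auto simp: derived_graph_def add.commute)
  also have "\<dots> = adj_op Y (base_vertex j)"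
    unfolding adj_op_def edges_from_def[symmetric] base_vertex_def lin_ext_single edges_from_base[OF j]
    by (simp add: module.scale_one[OF module_pm_scale])
  finally show ?thesis by simp
qed

text \<open>The valency in \<open>Y\<close> is that in \<open>X\<close> times the order of
  \<open>H (v j)\<close>, and \<open>group_sum j\<close> acts on the base vertex as this order
  because the subgroup fixes it.\<close>

lemma deg_op_base_vertex:
  assumes j: "j < g"
  shows "deg_op Y (base_vertex j) = S (degree_const j * group_sum j) (base_vertex j)"
proof -
  interpret m: Modules.module S by (rule module_vertex_act)
  have "val Y (v j, H (v j)) = val X (v j) * card (H (v j))"
    unfolding val_def edges_from_def[symmetric] edges_from_base[OF j] by (simp add: card_cartesian_product)
  then have "deg_op Y (base_vertex j) = Poly_Mapping.single (v j, H (v j)) (of_nat (val X (v j) * card (H (v j))))"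
    by (simp add: deg_op_def base_vertex_def lin_ext_single pm_scale_single)
  moreover have "S (group_sum j) (base_vertex j) = (\<Sum>a\<in>H (v j). Poly_Mapping.single (v j, H (v j)) 1)"
    unfolding group_sum_def m.scale_sum_left base_vertex_def
    by (rule sum.cong)
      (auto simp: group_ring_scale_single vertex_act_def coset_eq_self_iff[OF subgroup_v[OF j], THEN iffD2])
  then have "S (group_sum j) (base_vertex j) = Poly_Mapping.single (v j, H (v j)) (of_nat (card (H (v j))))"
    by (simp, intro poly_mapping_eqI) (simp add: lookup_sum lookup_single when_def)
  \<comment> \<open>A natural number in the group ring is a multiple of the neutral element
    \<open>0\<close>, so it acts as a complex scalar.\<close>
  then have "S (degree_const j * group_sum j) (base_vertex j)
      = S (Poly_Mapping.single 0 (of_nat (val X (v j)))) (Poly_Mapping.single (v j, H (v j)) (of_nat (card (H (v j)))))"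
    by (simp add: degree_const_def flip: m.scale_scale)
  ultimately show ?thesis
    by (simp add: group_ring_scale_single vertex_act_0 del: single_of_nat)
qed

lemma ihara_op_base_vertex:
  assumes j: "j < g"
  shows "ihara_op Y [:base_vertex j:] =
    (\<Sum>i<g. poly_scale S (ihara_entry edge_sum group_sum degree_const i j) [:base_vertex i:])"
proof (rule poly_eqI)
  fix n
  interpret m: Modules.module S by (rule module_vertex_act)
  interpret adj: module_hom S S "adj_op Y" by (rule module_hom_adj_op)
  interpret deg: module_hom S S "deg_op Y" by (rule module_hom_deg_op)
  have delta: "(\<Sum>i<g. S (if i = j then a else 0) (base_vertex i)) = S a (base_vertex j)" for a
  proof -
    have "(\<Sum>i<g. S (if i = j then a else 0) (base_vertex i)) = (\<Sum>i<g. if i = j then S a (base_vertex j) else 0)"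
      by (rule sum.cong) auto
    then show ?thesis using j by simp
  qed
  have "Polynomial.coeff (\<Sum>i<g. poly_scale S (ihara_entry edge_sum group_sum degree_const i j) [:base_vertex i:]) n
      = (\<Sum>i<g. S (Polynomial.coeff (ihara_entry edge_sum group_sum degree_const i j) n) (base_vertex i))"
    by (simp add: Polynomial.coeff_sum coeff_poly_scale_const[OF module_vertex_act])
  also have "\<dots> = Polynomial.coeff [:base_vertex j, - adj_op Y (base_vertex j), deg_op Y (base_vertex j) - base_vertex j:] n"
  proof -
    consider "n = 0" | "n = 1" | "n = 2" | "n > 2" by linarith
    then show ?thesis
    proof cases
      case 1
      then show ?thesis by (simp add: ihara_entry_def delta)
    next
      case 2
      then show ?thesis using j by (simp add: ihara_entry_def adj_op_base_vertex sum_negf)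
    next
      case 3
      then show ?thesis
        using j by (simp add: ihara_entry_def numeral_2_eq_2 delta deg_op_base_vertex m.scale_left_diff_distrib)
    next
      case 4
      then show ?thesis by (auto simp: ihara_entry_def coeff_pCons split: nat.splits)
    qed
  qed
  also have "[:base_vertex j, - adj_op Y (base_vertex j), deg_op Y (base_vertex j) - base_vertex j:] = ihara_op Y [:base_vertex j:]"
    by (simp add: ihara_op_def Polynomial.map_poly_pCons adj.zero deg.zero)
  finally show "Polynomial.coeff (ihara_op Y [:base_vertex j:]) n
    = Polynomial.coeff (\<Sum>i<g. poly_scale S (ihara_entry edge_sum group_sum degree_const i j) [:base_vertex i:]) n"
    by simp
qed

lemma eta_derived_graph:
  "eta vertex_act Y = det (mat g g (\<lambda>(i, j).
     [:average (H (v i)):] * ihara_entry edge_sum group_sum degree_const i j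
       + (if i = j then 1 - [:average (H (v i)):] else 0)))"
  unfolding eta_def
proof (rule endo_det_idempotent_generators[where x = "\<lambda>i. [:base_vertex i:]"])
  show "poly_scale S [:average (H (v i)):] [:base_vertex i:] = [:base_vertex i:]" if "i < g" for i
    by (rule poly_eqI)
      (auto simp: coeff_poly_scale_const[OF module_vertex_act] coeff_pCons base_vertex_def
        average_fixes[OF subgroup_v[OF that]] module.scale_zero_left[OF module_vertex_act] split: nat.splits)
qed (fact module_poly_scale[OF module_vertex_act] module_hom_ihara_op base_vertices_annihilator
    span_base_vertices ihara_op_base_vertex)+

section \<open>Specialization at a character\<close>

definition char_edge_sum :: "('g \<Rightarrow> complex) \<Rightarrow> nat \<Rightarrow> nat \<Rightarrow> complex" where
  "char_edge_sum \<psi> i j = (\<Sum>s\<in>{s \<in> dedges X. orig X s = v j \<and> termin X s = v i}. \<psi> (\<alpha> s))"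

definition char_group_sum :: "('g \<Rightarrow> complex) \<Rightarrow> nat \<Rightarrow> complex" where
  "char_group_sum \<psi> j = (\<Sum>a\<in>H (v j). \<psi> a)"

definition char_entry :: "('g \<Rightarrow> complex) \<Rightarrow> nat \<Rightarrow> nat \<Rightarrow> complex poly" where
  "char_entry \<psi> = ihara_entry (char_edge_sum \<psi>) (char_group_sum \<psi>) (\<lambda>j. of_nat (val X (v j)))"

lemma char_group_sum_eq:
  assumes "is_character \<psi>" "j < g"
  shows "char_group_sum \<psi> j = (if H (v j) \<subseteq> char_ker \<psi> then of_nat (card (H (v j))) else 0)"
  unfolding char_group_sum_def by (rule sum_character_subgroup[OF assms(1) subgroup_v[OF assms(2)]])

lemma char_ext_average:
  assumes "is_character \<psi>" "i < g"
  shows "char_ext \<psi> (average (H (v i))) = (if H (v i) \<subseteq> char_ker \<psi> then 1 else 0)"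
proof -
  interpret \<psi>: comm_ring_hom "char_ext \<psi>" by (rule comm_ring_hom_char_ext[OF assms(1)])
  have "char_ext \<psi> (average (H (v i))) = char_group_sum \<psi> i / of_nat (card (H (v i)))"
    by (simp add: average_def char_group_sum_def \<psi>.hom_sum char_ext_single sum_divide_distrib)
  then show ?thesis
    using is_subgroup_card_pos[OF subgroup_v[OF assms(2)]] by (auto simp: char_group_sum_eq[OF assms])
qed

text \<open>The image of the idempotent decides each row: if it is 1, row \<open>i\<close> is that
  of the specialized matrix, and if it is 0, only the identity part remains.\<close>

lemma h_fun_eq_det:
  assumes \<psi>: "is_character \<psi>"
  shows "h_fun X H \<alpha> \<psi> =
    det (mat g g (\<lambda>(i, j). if H (v i) \<subseteq> char_ker \<psi> then char_entry \<psi> i j else if i = j then 1 else 0))"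
proof -
  interpret \<psi>: comm_ring_hom "char_ext \<psi>" by (rule comm_ring_hom_char_ext[OF \<psi>])
  interpret p: map_poly_comm_ring_hom "char_ext \<psi>" ..
  have deg: "char_ext \<psi> (of_nat n) = of_nat n" for n
    by (rule \<psi>.hom_of_nat)
  have edge: "char_ext \<psi> (edge_sum i j) = char_edge_sum \<psi> i j" for i j
    by (simp add: edge_sum_def char_edge_sum_def \<psi>.hom_sum char_ext_single)
  have grp: "char_ext \<psi> (group_sum j) = char_group_sum \<psi> j" for j
    by (simp add: group_sum_def char_group_sum_def \<psi>.hom_sum char_ext_single)
  have entry: "map_poly (char_ext \<psi>) (ihara_entry edge_sum group_sum degree_const i j) = char_entry \<psi> i j" for i j
    unfolding map_poly_ihara_entry[OF comm_ring_hom_char_ext[OF \<psi>]] char_entry_def degree_const_def deg edge grp ..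
  have const: "map_poly (char_ext \<psi>) [:average (H (v i)):] = (if H (v i) \<subseteq> char_ker \<psi> then 1 else 0)" if "i < g" for i
    by (rule poly_eqI)
      (auto simp: coeff_map_poly coeff_pCons char_ext_average[OF \<psi> that] one_pCons split: nat.splits)
  show ?thesis
    unfolding h_fun_def eta_derived_graph p.hom_det[symmetric]
    by (rule arg_cong[of _ _ det], rule eq_matI)
      (simp_all add: p.hom_add p.hom_mult p.hom_minus entry const del: mult_pCons_left)
qed

lemma char_ext_int_mats:
  assumes \<psi>: "is_character \<psi>" and "i < g" "j < g"
  shows "char_ext_int \<psi> (A_mat g v X \<alpha> $$ (i, j)) = char_edge_sum \<psi> i j"
    and "char_ext_int \<psi> (C_mat g v H $$ (i, j)) = (if i = j then char_group_sum \<psi> i else 0)"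
    and "char_ext_int \<psi> (D_mat g v X $$ (i, j)) = (if i = j then of_nat (val X (v i)) else 0)"
proof -
  interpret \<psi>: comm_ring_hom "char_ext_int \<psi>" by (rule comm_ring_hom_char_ext_int[OF \<psi>])
  show "char_ext_int \<psi> (A_mat g v X \<alpha> $$ (i, j)) = char_edge_sum \<psi> i j"
    "char_ext_int \<psi> (C_mat g v H $$ (i, j)) = (if i = j then char_group_sum \<psi> i else 0)"
    "char_ext_int \<psi> (D_mat g v X $$ (i, j)) = (if i = j then of_nat (val X (v i)) else 0)"
    using assms
    by (simp_all add: A_mat_def C_mat_def D_mat_def char_edge_sum_def char_group_sum_def \<psi>.hom_sum
        \<psi>.hom_of_nat char_ext_int_single)
qed

lemma z_fun_eq_det:
  assumes \<psi>: "is_character \<psi>"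
  shows "z_fun g v X H \<alpha> \<psi> = det (mat g g (\<lambda>(i, j). char_entry \<psi> i j))"
proof -
  interpret \<psi>: comm_ring_hom "char_ext_int \<psi>" by (rule comm_ring_hom_char_ext_int[OF \<psi>])
  interpret p: map_poly_comm_ring_hom "char_ext_int \<psi>" ..
  have xi: "xi g v X H \<alpha> = det (mat g g (\<lambda>(i, j). ihara_entry (\<lambda>i j. A_mat g v X \<alpha> $$ (i, j))
      (\<lambda>j. C_mat g v H $$ (j, j)) (\<lambda>j. D_mat g v X $$ (j, j)) i j))"
    unfolding xi_def by (rule ihara_det_diagonal) (auto simp: A_mat_def C_mat_def D_mat_def)
  have "map_poly (char_ext_int \<psi>) (ihara_entry (\<lambda>i j. A_mat g v X \<alpha> $$ (i, j))
      (\<lambda>j. C_mat g v H $$ (j, j)) (\<lambda>j. D_mat g v X $$ (j, j)) i j) = char_entry \<psi> i j"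
    if "i < g" "j < g" for i j
    unfolding map_poly_ihara_entry[OF comm_ring_hom_char_ext_int[OF \<psi>]]
    using that by (simp add: char_entry_def ihara_entry_def char_ext_int_mats[OF \<psi>])
  then show ?thesis
    unfolding z_fun_def xi p.hom_det[symmetric]
    by (intro arg_cong[of _ _ det] eq_matI) simp_all
qed

end

section \<open>Comparison of the three determinants through their common block\<close>

theorem theorem6p6:
  fixes X :: "('v, 'e) sgraph"
    and g :: nat
    and v :: "nat \<Rightarrow> 'v"
    and H :: "'v \<Rightarrow> 'g::{finite, ab_group_add} set"
    and \<alpha> :: "'e \<Rightarrow> 'g"
    and \<psi> :: "'g \<Rightarrow> complex"
  assumes "finite_graph X"
    and "bij_betw v {0..<g} (verts X)"
    and "\<And>w. w \<in> verts X \<Longrightarrow> is_subgroup (H w)"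
    and "voltage X \<alpha>"
    and "is_character \<psi>"
  shows "(1 - [:0, 1:]\<^sup>2) ^ r0 g v H \<psi> * h_fun X H \<alpha> \<psi> = z_fun g v X H \<alpha> \<psi> \<and>
         h_fun X H \<alpha> \<psi> =
           ihara_det (card (verts X) - r0 g v H \<psi>)
             (map_mat (char_ext_int \<psi>) (trim g v H \<psi> (A_mat g v X \<alpha>)))
             (map_mat (char_ext_int \<psi>) (trim g v H \<psi> (C_mat g v H)))
             (map_mat (char_ext_int \<psi>) (trim g v H \<psi> (D_mat g v X)))"
proof -
  interpret labelled_graph X g v H \<alpha> by (unfold_locales; fact assms)
  note \<psi> = assms(5)
  define K where "K = {i. i < g \<and> H (v i) \<subseteq> char_ker \<psi>}"
  define k where "k = card K"
  let ?T = "char_entry \<psi>"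
  let ?dK = "det (mat k k (\<lambda>(i, j). ?T (pick K i) (pick K j)))"
  have K: "K \<subseteq> {..<g}" "finite K" by (auto simp: K_def)
  have "bij_betw (pick K) {..<k} K" unfolding k_def by (rule bij_betw_pick[OF K(2)])
  then have pick: "pick K i \<in> K" "pick K i < g" and pick_eq: "j < k \<Longrightarrow> pick K i = pick K j \<longleftrightarrow> i = j"
    if "i < k" for i j
    using that K(1) by (auto simp: bij_betw_def inj_on_def)
  \<comment> \<open>For \<open>j\<close> outside \<open>K\<close> the character sum over
    \<open>H (v j)\<close> is 0. The u term and the degree term of column \<open>j\<close>
    disappear, leaving 1 - u^2 on the diagonal.\<close>
  have bad: "?T i j = (if i = j then 1 - [:0, 1:]\<^sup>2 else 0)" if "j < g" "j \<notin> K" for i j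
    using that char_group_sum_eq[OF \<psi> that(1)]
    by (auto simp: K_def char_entry_def ihara_entry_def one_pCons power2_eq_square)
  have r0: "r0 g v H \<psi> = card ({..<g} - K)"
    unfolding r0_def by (rule arg_cong[of _ _ card]) (auto simp: K_def)
  have "card (verts X) = g" using bij_betw_same_card[OF assms(2)] by simp
  then have size: "card (verts X) - r0 g v H \<psi> = k"
    using K card_mono[OF _ K(1)] by (simp add: r0 k_def card_Diff_subset)

  \<comment> \<open>Outside \<open>K\<close> the idempotent replaces the diagonal entry 1 - u^2 by
    1, so no factor arises when these columns are deleted.\<close>
  let ?B = "mat g g (\<lambda>(i, j). if H (v i) \<subseteq> char_ker \<psi> then ?T i j else if i = j then 1 else 0)"
  have "h_fun X H \<alpha> \<psi> = det ?B" by (rule h_fun_eq_det[OF \<psi>])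
  also have "\<dots> = det (mat k k (\<lambda>(a, b). ?B $$ (pick K a, pick K b)))"
    unfolding k_def
  proof (rule det_unit_columns[OF _ K(1)])
    fix i j assume "i < g" "j < g" "j \<notin> K"
    then show "?B $$ (i, j) = (if i = j then 1 else 0)" by (auto simp: bad K_def)
  qed simp
  also have "\<dots> = ?dK"
    by (rule arg_cong[of _ _ det], rule eq_matI) (use pick in \<open>auto simp: K_def\<close>)
  finally have h: "h_fun X H \<alpha> \<psi> = ?dK" .

  \<comment> \<open>Here the entries 1 - u^2 survive, one for each index outside \<open>K\<close>;
    they give the power \<open>r0 g v H \<psi>\<close>.\<close>
  let ?Z = "mat g g (\<lambda>(i, j). ?T i j)"
  have "z_fun g v X H \<alpha> \<psi> = det ?Z" by (rule z_fun_eq_det[OF \<psi>])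
  also have "\<dots> = (1 - [:0, 1:]\<^sup>2) ^ card ({..<g} - K) * det (mat k k (\<lambda>(a, b). ?Z $$ (pick K a, pick K b)))"
    unfolding k_def
  proof (rule det_scaled_unit_columns[OF _ K(1)])
    fix i j assume "i < g" "j < g" "j \<notin> K"
    then show "?Z $$ (i, j) = (if i = j then 1 - [:0, 1:]\<^sup>2 else 0)" by (simp add: bad)
  qed simp
  also have "mat k k (\<lambda>(a, b). ?Z $$ (pick K a, pick K b)) = mat k k (\<lambda>(i, j). ?T (pick K i) (pick K j))"
    by (rule eq_matI) (use pick in auto)
  finally have z: "z_fun g v X H \<alpha> \<psi> = (1 - [:0, 1:]\<^sup>2) ^ r0 g v H \<psi> * ?dK" unfolding r0 .

  \<comment> \<open>\<open>submatrix\<close> takes its size from the indices that lie both in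
    \<open>K\<close> and below the dimension of the matrix.\<close>
  have dims: "{i. i < g \<and> i \<in> K} = K" using K(1) by auto
  have trim: "trim g v H \<psi> B = mat k k (\<lambda>(i, j). B $$ (pick K i, pick K j))"
    if "B \<in> carrier_mat g g" for B :: "('g \<Rightarrow>\<^sub>0 int) mat"
    using that unfolding trim_def submatrix_def Let_def K_def[symmetric] k_def
    by (auto simp: dims)
  have carr: "A_mat g v X \<alpha> \<in> carrier_mat g g" "C_mat g v H \<in> carrier_mat g g"
      "(D_mat g v X :: ('g \<Rightarrow>\<^sub>0 int) mat) \<in> carrier_mat g g"
    by (auto simp: A_mat_def C_mat_def D_mat_def)
  \<comment> \<open>\<open>pick K\<close> is injective on the positions below \<open>k\<close>, so
    the trimmed matrices of \<open>C\<close> and \<open>D\<close> stay diagonal and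
    \<open>ihara_det_diagonal\<close> applies to them.\<close>
  have "ihara_det k (map_mat (char_ext_int \<psi>) (trim g v H \<psi> (A_mat g v X \<alpha>)))
             (map_mat (char_ext_int \<psi>) (trim g v H \<psi> (C_mat g v H)))
             (map_mat (char_ext_int \<psi>) (trim g v H \<psi> (D_mat g v X)))
      = det (mat k k (\<lambda>(i, j). ihara_entry (\<lambda>i j. char_edge_sum \<psi> (pick K i) (pick K j))
          (\<lambda>j. char_group_sum \<psi> (pick K j)) (\<lambda>j. of_nat (val X (v (pick K j)))) i j))"
    unfolding trim[OF carr(1)] trim[OF carr(2)] trim[OF carr(3)]
    by (rule ihara_det_diagonal) (simp_all add: pick char_ext_int_mats[OF \<psi>] pick_eq)
  also have "\<dots> = ?dK"
    by (rule arg_cong[of _ _ det], rule eq_matI) (simp_all add: char_entry_def ihara_entry_def pick_eq)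
  finally show ?thesis using h z size by simp
qed

end
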